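(* Let $A$ be a unital $A_\infty$-algebra with unit $I$. For a negative cyclic cocycle $\alpha$ let $\Psi^\alpha$ be the potential $$\Psi^\alpha(x)=\sum_{p,q\ge0}\frac1{p+q+1}\,\widetilde{\alpha_0}(\underbrace{x,\dots,x}_{p},\underline{x},\underbrace{x,\dots,x}_{q})(I)$$ associated with the $A_\infty$-bimodule map $\widetilde{\alpha}=\widetilde{\alpha_0}:A\to A^*$. Then $\alpha\mapsto\Psi^\alpha|_{MC}$ provides a (well-defined) map $$\Psi:HC_-^\bullet(A)\to\mathcal{O}(\mathcal{MC}).$$ Furthermore, this map agrees with the algebraic generalized holonomy map $\rho:HC^\bullet_-(A)\to\mathcal{O}(\mathcal{MC})$ of Abbaspour, Tradler and Zeinalian, $\rho([\alpha])([a])=\langle\alpha,P(a)\rangle$.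
   Context: Conventions. $\boldsymbol{k}$ is a field of characteristic $0$; $|x|'=|x|-1$ is the shifted degree. An $A_\infty$-algebra $(A,\{m_k\}_{k\ge1})$ is a graded vector space (with $H^\bullet(A)$ finite dimensional) with multilinear maps $m_k:A^{\otimes k}\to A$ of degree $1$ for the shifted degree with $\sum_{i,j}(-1)^{|x_1|'+\cdots+|x_i|'}m_{n-j+1}(x_1,\dots,x_i,m_j(x_{i+1},\dots,x_{i+j}),\dots,x_n)=0$ for all $n\ge1$. A unit is $I\in A^0$ with $m_2(I,x)=(-1)^{\deg x}m_2(x,I)=x$ and $m_k(\dots,I,\dots)=0$ for $k\ne2$. Reduced Hochschild and negative cyclic complexes. Reduced Hochschild chains are spanned by $w\otimes x_1\otimes\cdots\otimes x_n\in A\otimes(A[1]/\boldsymbol{k}I)^{\otimes n}$, $n\ge0$, with $b(w\otimes x_1\otimes\cdots\otimes x_n)=\sum_{i,j}(-1)^{|w|'+|x_1|'+\cdots+|x_i|'}w\otimes x_1\otimes\cdots\otimes x_i\otimes m_j(x_{i+1},\dots,x_{i+j})\otimes\cdots\otimes x_n+\sum_{i,j\ge0,\,i+j\le n}(-1)^{\epsilon}m_{i+j+1}(x_{n-j+1},\dots,x_n,w,x_1,\dots,x_i)\otimes x_{i+1}\otimes\cdots\otimes x_{n-j}$, $\epsilon=(\sum_{s>n-j}|x_s|')(|w|'+\sum_{s\le n-j}|x_s|')$, and Connes–Tsygan operator $B(w\otimes x_1\otimes\cdots\otimes x_n)=\sum_{i=0}^n(-1)^{(|w|'+\sum_{s\le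 i}|x_s|')(\sum_{s>i}|x_s|')}I\otimes x_{i+1}\otimes\cdots\otimes x_n\otimes w\otimes x_1\otimes\cdots\otimes x_i$. Negative cyclic homology $HC^-_\bullet(A)$ is computed by (reduced chains)$[[u]]$ with differential $b+uB$. Reduced cochains $C^\bullet_{red}(A,A^* )$ are the dual of reduced chains; a cochain $\beta$ is written as multilinear maps $\beta(x_1,\dots,x_n)\in A^*$ vanishing when some $x_i\in\boldsymbol{k}I$, with $\langle\beta,w\otimes x_1\otimes\cdots\otimes x_n\rangle=(-1)^{|w|'(|x_1|'+\cdots+|x_n|')}\beta(x_1,\dots,x_n)(w)$. Negative cyclic cohomology $HC_-^\bullet(A)$ is the cohomology of the dual complex $C^\bullet_{red}(A,A^* )\otimes\boldsymbol{k}[u^{-1}]$, whose elements are finite sums $\alpha=\sum_{i\ge0}\alpha_iu^{-i}$, with pairing $\langle\alpha,\sum_ic_iu^i\rangle=\sum_i\langle\alpha_i,c_i\rangle$; the cocycle condition is $b^*\alpha_i+B^*\alpha_{i+1}=0$ for all $i\ge0$. Thus $\alpha_0$ is the part of $\alpha$ dual to the inclusion of Hochschild chains as $u^0$-terms. The bimodule map. An $A_\infty$-bimodule map $A\to A^*$ is a family of maps $A^{\otimes p}\otimes\underline A\otimes A^{\otimes q}\to A^*$ compatible with the $A_\infty$-bimodule structures on $A$ and its dual (underline marks the bimodule entry). For a negative cyclic cocycle $\alpha$, $$\widetilde{\alpha_0}(\vec a,\underline v,\vec b)(w)=\alpha_0(\vec a,v,\vec b)(w)-(-1)^{(|\vec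 a|'+|v|')(|\vec b|'+|w|')}\alpha_0(\vec b,w,\vec a)(v),$$ where $|\vec a|'$ is the sum of the shifted degrees of the entries of $\vec a$, etc. It is known that this is an $A_\infty$-bimodule map $A\to A^*$ that is skew symmetric and satisfies the closedness condition of strong homotopy inner products; if $\alpha$ is homologically non-degenerate it is a strong homotopy inner product, but $\Psi^\alpha$ is defined by the same formula for every $\alpha$. Maurer–Cartan elements. $a\in A^1$ is a Maurer–Cartan element if $\sum_{k\ge1}m_k(a,\dots,a)=0$; $MC$ is the set of these. $a,\widetilde a\in MC$ are gauge equivalent if there are $a(t)\in A^1[t]$, $c(t)\in A^0[t]$ with $a(0)=a$, $a(1)=\widetilde a$ and $\frac{d}{dt}a(t)=\sum_{k\ge1}m_k(a(t),\dots,a(t),c(t),a(t),\dots,a(t))$ (sum over all positions of $c(t)$). $\mathcal{MC}=MC/\sim$ is the quotient by gauge equivalence and $\mathcal{O}(\mathcal{MC})$ its ring of $\boldsymbol{k}$-valued functions. The holonomy map. For $a\in MC$ put $P(a)=(I\otimes I)+(I\otimes a)+(I\otimes a\otimes a)+\cdots$, a reduced Hochschild chain (the term $I\otimes I$ is zero in the reduced complex). It is known that $bP(a)=0$ and $BP(a)=0$, so $P(a)$ is a negative cyclic cycle, and $\rho([\alpha])([a]):=\langle\alpha,P(a)\rangle=\sum_{i\ge1}\alpha_0(\underbrace{a,\dots,a}_{i})(I)$. Convention on infinite sums. All infinite sums occurring (Maurer–Cartan and gauge equations, $P(a)$, $\Psi^\alpha$, and sums derived from them) are assumed to make sense, and may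 be rearranged, differentiated term by term and inserted in the multilinear operations. *)

theory Defs
  imports
    "HOL-Analysis.Infinite_Sum"
    "HOL-Computational_Algebra.Polynomial"
    "HOL-Library.Poly_Mapping"
    "HOL-Library.FuncSet"
begin

section \<open>Unital $A_\infty$-algebras\<close>

text \<open>
  The underlying vector space is the whole type \<open>'a\<close>; \<open>gr d\<close> is its degree \<open>d\<close> part.  The maps
  $m_k$ are collected in one function \<open>mul\<close> on lists: \<open>mul xs\<close> is $m_k(x_1,\dots,x_k)$ with
  \<open>k = length xs\<close>.  Only \<open>k \<ge> 1\<close> is meaningful; \<open>mul []\<close> is never used.
  That $m_k$ has degree 1 for the shifted degree $d-1$ is expressed by the value having degree
  $\sum_i(d_i-1)+2$.
\<close>

record ('k, 'a) ainf =
  smul :: "'k \<Rightarrow> 'a \<Rightarrow> 'a"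
  gr :: "int \<Rightarrow> 'a set"
  mul :: "'a list \<Rightarrow> 'a"
  one :: "'a"

text \<open>
  The degree is meant for homogeneous elements.  The degree of \<open>0\<close> is an arbitrary
  integer; it only enters signs of terms that vanish by multilinearity.
\<close>

definition homogeneous :: "('k, 'a) ainf \<Rightarrow> 'a \<Rightarrow> bool" where
  "homogeneous A x \<longleftrightarrow> (\<exists>d. x \<in> gr A d)"

definition deg :: "('k, 'a) ainf \<Rightarrow> 'a \<Rightarrow> int" where
  "deg A x = (SOME d. x \<in> gr A d)"

definition sdeg :: "('k, 'a) ainf \<Rightarrow> 'a \<Rightarrow> int" where
  "sdeg A x = deg A x - 1"

definition sdegs :: "('k, 'a) ainf \<Rightarrow> 'a list \<Rightarrow> int" where
  "sdegs A xs = (\<Sum>x\<leftarrow>xs. sdeg A x)"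

definition graded_vector_space :: "('k::field, 'a::ab_group_add) ainf \<Rightarrow> bool" where
  "graded_vector_space A \<longleftrightarrow>
     vector_space (smul A) \<and>
     (\<forall>d. module.subspace (smul A) (gr A d)) \<and>
     (\<forall>x. \<exists>!f. (\<forall>d. f d \<in> gr A d) \<and> finite {d. f d \<noteq> 0} \<and> x = (\<Sum>d | f d \<noteq> 0. f d))"

definition finite_dim_cohomology :: "('k::field, 'a::ab_group_add) ainf \<Rightarrow> bool" where
  "finite_dim_cohomology A \<longleftrightarrow>
     (\<exists>S. finite S \<and> S \<subseteq> {x. mul A [x] = 0} \<and>
          {x. mul A [x] = 0} \<subseteq> {s + mul A [y] | s y. s \<in> module.span (smul A) S})"

definition ainf_algebra :: "('k::field, 'a::ab_group_add) ainf \<Rightarrow> bool" where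
  "ainf_algebra A \<longleftrightarrow>
     graded_vector_space A \<and>
     (\<forall>us vs. Vector_Spaces.linear (smul A) (smul A) (\<lambda>x. mul A (us @ x # vs))) \<and>
     (\<forall>ds xs. xs \<noteq> [] \<longrightarrow> list_all2 (\<lambda>d x. x \<in> gr A d) ds xs \<longrightarrow>
        mul A xs \<in> gr A ((\<Sum>d\<leftarrow>ds. d - 1) + 2)) \<and>
     (\<forall>xs. xs \<noteq> [] \<longrightarrow> list_all (homogeneous A) xs \<longrightarrow>
        (\<Sum>(i, j) \<in> {(i, j). 1 \<le> j \<and> i + j \<le> length xs}.
           smul A ((- 1) powi sdegs A (take i xs))
             (mul A (take i xs @ mul A (take j (drop i xs)) # drop (i + j) xs))) = 0) \<and>
     finite_dim_cohomology A"

definition strict_unit :: "('k::field, 'a::ab_group_add) ainf \<Rightarrow> bool" where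
  "strict_unit A \<longleftrightarrow>
     one A \<in> gr A 0 \<and>
     (\<forall>d. \<forall>x \<in> gr A d. mul A [one A, x] = x \<and> smul A ((- 1) powi d) (mul A [x, one A]) = x) \<and>
     (\<forall>us vs. length (us @ one A # vs) \<noteq> 2 \<longrightarrow> mul A (us @ one A # vs) = 0)"

section \<open>Convention on infinite sums\<close>

text \<open>
  Infinite sums are unconditional sums (\<open>has_sum\<close>) with respect to topologies on \<open>'k\<close> and \<open>'a\<close>
  for which both are Hausdorff topological groups under addition (such groups are always
  regular, i.e. \<open>t3_space\<close>).  For the discrete topology this says that all but finitely many terms
  vanish.  A family ``makes sense and may be rearranged'' if all its
  subfamilies are summable; in complete groups this is the same as being summable.
\<close>

definition freely_summable_on ::
    "('i \<Rightarrow> 'b::{comm_monoid_add, topological_space}) \<Rightarrow> 'i set \<Rightarrow> bool" where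
  "freely_summable_on f S \<longleftrightarrow> (\<forall>T \<subseteq> S. f summable_on T)"

text \<open>Infinite sums may be inserted in every slot of the multilinear operation \<open>\<phi>\<close>.\<close>

definition sums_insertable ::
    "('a::{comm_monoid_add, topological_space} list
       \<Rightarrow> 'b::{comm_monoid_add, topological_space}) \<Rightarrow> bool" where
  "sums_insertable \<phi> \<longleftrightarrow>
     (\<forall>us vs (f :: nat \<Rightarrow> 'a) s. (f has_sum s) UNIV \<longrightarrow>
        ((\<lambda>n. \<phi> (us @ f n # vs)) has_sum \<phi> (us @ s # vs)) UNIV)"

definition unital_ainf_algebra ::
    "('k::field, 'a::{ab_group_add, topological_space}) ainf \<Rightarrow> bool" where
  "unital_ainf_algebra A \<longleftrightarrow> ainf_algebra A \<and> strict_unit A \<and> sums_insertable (mul A)"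

text \<open>
  The terms of $\phi(P(a))$ and of $\phi(bP(a))$, for \<open>\<phi>\<close> a multilinear operation of variable
  arity in which the entry \<open>I\<close> of the chain $P(a)$ is suppressed.
\<close>

definition point_sums_ok :: "('k, 'a) ainf \<Rightarrow>
    ('a list \<Rightarrow> 'b::{comm_monoid_add, topological_space}) \<Rightarrow> 'a \<Rightarrow> bool" where
  "point_sums_ok A \<phi> a \<longleftrightarrow>
     freely_summable_on (\<lambda>n. \<phi> (replicate n a)) {1..} \<and>
     freely_summable_on
       (\<lambda>(i, j, l). \<phi> (replicate i a @ mul A (replicate j a) # replicate l a)) {(i, j, l). 1 \<le> j}"

text \<open>
  For polynomials $a(t)=\sum_i a_it^i$ and $c(t)=\sum_j c_jt^j$, the expansion in monomials
  of $\phi(a(t),\dots,a(t))$ and of its derivative along the gauge equation: one evaluation of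
  \<open>m\<close> is inserted in \<open>\<phi>\<close>, and \<open>c(t)\<close> occurs once, inside or outside that evaluation.  A list \<open>u\<close> of
  exponents stands for the word $a_{u_1},a_{u_2},\dots$.
\<close>

definition path_sums_ok :: "('k, 'a::zero) ainf \<Rightarrow>
    ('a list \<Rightarrow> 'b::{comm_monoid_add, topological_space}) \<Rightarrow> 'a poly \<Rightarrow> 'a poly \<Rightarrow> bool" where
  "path_sums_ok A \<phi> a c \<longleftrightarrow>
     (let w = map (coeff a) in
        freely_summable_on (\<lambda>u. \<phi> (w u)) {u. u \<noteq> []} \<and>
        freely_summable_on
          (\<lambda>(u, r, j, s, v). \<phi> (w u @ mul A (w r @ coeff c j # w s) # w v)) UNIV \<and>
        freely_summable_on
          (\<lambda>(u, r, s, j, v). \<phi> (w u @ mul A (w r) # w s @ coeff c j # w v))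
          {(u, r, s, j, v). r \<noteq> []} \<and>
        freely_summable_on
          (\<lambda>(u, j, s, r, v). \<phi> (w u @ coeff c j # w s @ mul A (w r) # w v))
          {(u, j, s, r, v). r \<noteq> []})"

section \<open>Maurer--Cartan elements and gauge equivalence\<close>

definition MC :: "('k, 'a::{ab_group_add, topological_space}) ainf \<Rightarrow> 'a set" where
  "MC A = {a \<in> gr A 1. ((\<lambda>k. mul A (replicate k a)) has_sum 0) {1..}}"

text \<open>Coefficient of $t^N$ in $m_k(p_1(t),\dots,p_k(t))$, where $m_k$ is extended $k[t]$-linearly.\<close>

definition mul_coeff :: "('k, 'a::ab_group_add) ainf \<Rightarrow> 'a poly list \<Rightarrow> nat \<Rightarrow> 'a" where
  "mul_coeff A ps N =
     (\<Sum>is | length is = length ps \<and> sum_list is = N. mul A (map2 coeff ps is))"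

text \<open>
  The gauge equation is an identity of polynomials in the formal variable $t$; the infinite sum is
  taken coefficientwise.  Here \<open>p\<close> and \<open>q\<close> are the numbers of entries $a(t)$ before and after $c(t)$.
\<close>

definition gauge_path ::
    "('k::field, 'a::{ab_group_add, topological_space}) ainf \<Rightarrow> 'a poly \<Rightarrow> 'a poly \<Rightarrow> bool" where
  "gauge_path A a c \<longleftrightarrow>
     (\<forall>i. coeff a i \<in> gr A 1) \<and> (\<forall>i. coeff c i \<in> gr A 0) \<and>
     (\<forall>N. ((\<lambda>(p, q). mul_coeff A (replicate p a @ c # replicate q a) N) has_sum
             smul A (of_nat (N + 1)) (coeff a (N + 1))) UNIV) \<and>
     path_sums_ok A (mul A) a c"

definition gauge_rel ::
    "('k::field, 'a::{ab_group_add, topological_space}) ainf \<Rightarrow> ('a \<times> 'a) set" where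
  "gauge_rel A = {(x, y). x \<in> MC A \<and> y \<in> MC A \<and>
     (\<exists>a c. gauge_path A a c \<and> coeff a 0 = x \<and> (\<Sum>i\<le>degree a. coeff a i) = y)}"

text \<open>The quotient by gauge equivalence is the quotient by the generated equivalence relation.\<close>

definition gauge_equiv ::
    "('k::field, 'a::{ab_group_add, topological_space}) ainf \<Rightarrow> ('a \<times> 'a) set" where
  "gauge_equiv A = (gauge_rel A \<union> (gauge_rel A)\<inverse>)\<^sup>* \<inter> (MC A \<times> MC A)"

definition MC_moduli ::
    "('k::field, 'a::{ab_group_add, topological_space}) ainf \<Rightarrow> 'a set set" where
  "MC_moduli A = MC A // gauge_equiv A"

definition MC_functions ::
    "('k::field, 'a::{ab_group_add, topological_space}) ainf \<Rightarrow> ('a set \<Rightarrow> 'k) set" where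
  "MC_functions A = (MC_moduli A \<rightarrow>\<^sub>E UNIV)"

section \<open>Reduced Hochschild chains and negative cyclic cohomology\<close>

text \<open>
  A Hochschild chain is represented by a formal linear combination of elementary tensors
  $w\otimes x_1\otimes\cdots\otimes x_n$, written \<open>(w, [x\<^sub>1, \<dots>, x\<^sub>n])\<close>.  The relations of the tensor product
  and of the reduction are not divided out; reduced cochains respect them by definition.
\<close>

type_synonym 'a tensor = "'a \<times> 'a list"
type_synonym ('k, 'a) chain = "'a tensor \<Rightarrow>\<^sub>0 'k"

definition homogeneous_tensor :: "('k, 'a) ainf \<Rightarrow> 'a tensor \<Rightarrow> bool" where
  "homogeneous_tensor A = (\<lambda>(w, xs). homogeneous A w \<and> list_all (homogeneous A) xs)"

definition hoch_b :: "('k::field, 'a) ainf \<Rightarrow> 'a tensor \<Rightarrow> ('k, 'a) chain" where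
  "hoch_b A = (\<lambda>(w, xs).
     (\<Sum>(i, j) \<in> {(i, j). 1 \<le> j \<and> i + j \<le> length xs}.
        Poly_Mapping.single
          (w, take i xs @ mul A (take j (drop i xs)) # drop (i + j) xs)
          ((- 1) powi (sdeg A w + sdegs A (take i xs)))) +
     (\<Sum>(i, j) \<in> {(i, j). i + j \<le> length xs}.
        (let rest = take (length xs - j) xs; tail = drop (length xs - j) xs in
           Poly_Mapping.single
             (mul A (tail @ w # take i xs), drop i rest)
             ((- 1) powi (sdegs A tail * (sdeg A w + sdegs A rest))))))"

definition connes_B :: "('k::field, 'a) ainf \<Rightarrow> 'a tensor \<Rightarrow> ('k, 'a) chain" where
  "connes_B A = (\<lambda>(w, xs).
     (\<Sum>i\<le>length xs.
        Poly_Mapping.single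
          (one A, drop i xs @ w # take i xs)
          ((- 1) powi ((sdeg A w + sdegs A (take i xs)) * sdegs A (drop i xs)))))"

type_synonym ('k, 'a) cochain = "'a list \<Rightarrow> 'a \<Rightarrow> 'k"

definition reduced_cochain ::
    "('k::field, 'a::ab_group_add) ainf \<Rightarrow> ('k, 'a) cochain \<Rightarrow> bool" where
  "reduced_cochain A \<beta> \<longleftrightarrow>
     (\<forall>xs. Vector_Spaces.linear (smul A) (*) (\<beta> xs)) \<and>
     (\<forall>us vs w. Vector_Spaces.linear (smul A) (*) (\<lambda>x. \<beta> (us @ x # vs) w)) \<and>
     (\<forall>us vs r w. \<beta> (us @ smul A r (one A) # vs) w = 0)"

definition pair_tensor ::
    "('k::field, 'a) ainf \<Rightarrow> ('k, 'a) cochain \<Rightarrow> 'a tensor \<Rightarrow> 'k" where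
  "pair_tensor A \<beta> = (\<lambda>(w, xs). (- 1) powi (sdeg A w * sdegs A xs) * \<beta> xs w)"

definition pair_chain ::
    "('k::field, 'a) ainf \<Rightarrow> ('k, 'a) cochain \<Rightarrow> ('k, 'a) chain \<Rightarrow> 'k" where
  "pair_chain A \<beta> c =
     (\<Sum>t \<in> Poly_Mapping.keys c. Poly_Mapping.lookup c t * pair_tensor A \<beta> t)"

text \<open>
  $P(a)$, given by the sequence of its terms $I\otimes I,\ I\otimes a,\ I\otimes a\otimes a,\dots$;
  it is a $u^0$-term, so that its pairing with \<open>\<alpha>\<close> only involves \<open>\<alpha> 0\<close>.
\<close>

definition P_term :: "('k, 'a) ainf \<Rightarrow> 'a \<Rightarrow> nat \<Rightarrow> 'a tensor" where
  "P_term A a n = (if n = 0 then (one A, [one A]) else (one A, replicate n a))"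

definition holonomy ::
    "('k::{field, t2_space}, 'a) ainf \<Rightarrow> (nat \<Rightarrow> ('k, 'a) cochain) \<Rightarrow> 'a \<Rightarrow> 'k" where
  "holonomy A \<alpha> a = (\<Sum>\<^sub>\<infinity>n. pair_tensor A (\<alpha> 0) (P_term A a n))"

text \<open>The bimodule map \<open>A \<rightarrow> A\<^sup>*\<close> of $\alpha_0$; the third argument is the bimodule entry.\<close>

definition bimodule_map ::
    "('k::field, 'a) ainf \<Rightarrow> ('k, 'a) cochain \<Rightarrow> 'a list \<Rightarrow> 'a \<Rightarrow> 'a list \<Rightarrow> 'a \<Rightarrow> 'k" where
  "bimodule_map A \<alpha>0 as v bs w =
     \<alpha>0 (as @ v # bs) w -
     (- 1) powi ((sdegs A as + sdeg A v) * (sdegs A bs + sdeg A w)) * \<alpha>0 (bs @ w # as) v"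

definition potential_term ::
    "('k::field, 'a) ainf \<Rightarrow> (nat \<Rightarrow> ('k, 'a) cochain) \<Rightarrow> 'a \<Rightarrow> nat \<times> nat \<Rightarrow> 'k" where
  "potential_term A \<alpha> x = (\<lambda>(p, q).
     1 / of_nat (p + q + 1) * bimodule_map A (\<alpha> 0) (replicate p x) x (replicate q x) (one A))"

definition potential ::
    "('k::{field, t2_space}, 'a) ainf \<Rightarrow> (nat \<Rightarrow> ('k, 'a) cochain) \<Rightarrow> 'a \<Rightarrow> 'k" where
  "potential A \<alpha> x = (\<Sum>\<^sub>\<infinity>pq. potential_term A \<alpha> x pq)"

text \<open>
  A reduced cochain is an arbitrary sequence of multilinear maps, so the infinite sums need not
  exist for all of them.  The convention that they do is imposed on the component \<open>\<alpha> 0\<close> of the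
  negative cyclic cochains $\alpha=\sum_i\alpha_iu^{-i}$; it is void if all sums are finite, e.g. if
  the topologies are discrete and all but finitely many $m_k$ and $\alpha_0$-components vanish.
\<close>

definition convergent_cochain :: "('k::{field, topological_space},
    'a::{ab_group_add, topological_space}) ainf \<Rightarrow> (nat \<Rightarrow> ('k, 'a) cochain) \<Rightarrow> bool" where
  "convergent_cochain A \<alpha> \<longleftrightarrow>
     (let \<phi> = (\<lambda>xs. \<alpha> 0 xs (one A)) in
        sums_insertable \<phi> \<and>
        (\<forall>a \<in> MC A. point_sums_ok A \<phi> a \<and> potential_term A \<alpha> a summable_on UNIV) \<and>
        (\<forall>a c. gauge_path A a c \<longrightarrow> path_sums_ok A \<phi> a c))"

definition neg_cochains :: "('k::{field, topological_space},
    'a::{ab_group_add, topological_space}) ainf \<Rightarrow> (nat \<Rightarrow> ('k, 'a) cochain) set" where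
  "neg_cochains A = {\<alpha>. (\<forall>i. reduced_cochain A (\<alpha> i)) \<and> finite {i. \<alpha> i \<noteq> (\<lambda>xs w. 0)} \<and>
     convergent_cochain A \<alpha>}"

text \<open>
  The differential dual to $b+uB$: the coefficient of $u^{-i}$ of the coboundary of \<open>\<alpha>\<close> is
  $b^*\alpha_i+B^*\alpha_{i+1}$, here evaluated on elementary tensors.
\<close>

definition neg_diff :: "('k::field, 'a) ainf \<Rightarrow>
    (nat \<Rightarrow> ('k, 'a) cochain) \<Rightarrow> nat \<Rightarrow> 'a tensor \<Rightarrow> 'k" where
  "neg_diff A \<alpha> i t = pair_chain A (\<alpha> i) (hoch_b A t) + pair_chain A (\<alpha> (i + 1)) (connes_B A t)"

definition neg_cocycles :: "('k::{field, topological_space},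
    'a::{ab_group_add, topological_space}) ainf \<Rightarrow> (nat \<Rightarrow> ('k, 'a) cochain) set" where
  "neg_cocycles A = {\<alpha> \<in> neg_cochains A. \<forall>i t. homogeneous_tensor A t \<longrightarrow> neg_diff A \<alpha> i t = 0}"

text \<open>
  In the third line the coboundary of \<open>\<gamma>\<close> is a difference of two elements of \<open>neg_cochains A\<close>.  Hence
  \<open>HC_neg\<close> is the cohomology of the complex of those \<open>\<gamma>\<close> for which both \<open>\<gamma>\<close> and its coboundary
  belong to \<open>neg_cochains A\<close>.
\<close>

definition cohomologous :: "('k::{field, topological_space},
    'a::{ab_group_add, topological_space}) ainf \<Rightarrow>
    ((nat \<Rightarrow> ('k, 'a) cochain) \<times> (nat \<Rightarrow> ('k, 'a) cochain)) set" where
  "cohomologous A = {(\<alpha>, \<alpha>'). \<alpha> \<in> neg_cocycles A \<and> \<alpha>' \<in> neg_cocycles A \<and>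
     (\<exists>\<gamma> \<in> neg_cochains A. \<forall>i t. homogeneous_tensor A t \<longrightarrow>
        pair_tensor A (\<alpha> i) t - pair_tensor A (\<alpha>' i) t = neg_diff A \<gamma> i t)}"

definition HC_neg :: "('k::{field, topological_space},
    'a::{ab_group_add, topological_space}) ainf \<Rightarrow> (nat \<Rightarrow> ('k, 'a) cochain) set set" where
  "HC_neg A = neg_cocycles A // cohomologous A"

end

theory Submission
  imports Defs
begin

text \<open>
  In the potential the second term of the bimodule map is a value of the reduced cochain \<open>\<alpha>\<^sub>0\<close> with
  the unit as an argument, so it vanishes, and the \<open>n\<close> pairs \<open>(p, q)\<close> with \<open>p + q + 1 = n\<close> contribute
  \<open>\<alpha>\<^sub>0(a, \<dots>, a)(I)\<close> with total weight 1: potential and holonomy agree term by term.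

  On a coboundary, \<open>b(I \<otimes> a \<otimes> \<cdots> \<otimes> a)\<close> consists of the insertions of one \<open>m\<^sub>j(a, \<dots>, a)\<close> and two
  terms from the unit that cancel; summing the insertions over \<open>j\<close> first gives \<open>0\<close> by the
  Maurer--Cartan equation.

  For gauge invariance let \<open>\<phi> = \<alpha>\<^sub>0(\<dots>)(I)\<close> and expand \<open>\<phi>(a(t), \<dots>, a(t))\<close> in powers of \<open>t\<close>.  By the gauge
  equation the coefficient of \<open>t\<^sup>M\<close> in the derivative is the sum over all ways to insert one operation
  that contains the letter \<open>c\<close>.  The cocycle condition on the words with one letter \<open>c\<close> turns this into
  insertions of operations without \<open>c\<close>, which sum to zero as long as \<open>a(t)\<close> satisfies the Maurer--Cartan
  equation up to order \<open>M\<close>.  The same argument with \<open>\<phi>\<close> replaced by the operations \<open>m\<close> and the cocycle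
  condition by the $A_\infty$ relations shows inductively that it does so to every order.
\<close>

section \<open>Infinite sums and multilinear maps\<close>

text \<open>Reindexing \<open>S\<close> as the disjoint union of the fibers of \<open>g\<close>
  reduces this to iterated summation. The fiber sums are hypotheses, since completeness is not
  assumed.\<close>

lemma has_sum_fibers:
  fixes f :: "'x \<Rightarrow> 'b::{topological_comm_monoid_add, t3_space}"
  assumes "(f has_sum s) S" and "g ` S \<subseteq> T"
    and "\<And>t. t \<in> T \<Longrightarrow> (f has_sum h t) {x \<in> S. g x = t}"
  shows "(h has_sum s) T"
proof (rule has_sum_SigmaD)
  have inj: "inj_on snd (Sigma T (\<lambda>t. {x \<in> S. g x = t}))"
    by (auto simp: inj_on_def)
  have "snd ` Sigma T (\<lambda>t. {x \<in> S. g x = t}) = S"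
    using assms(2) by force
  then show "((f \<circ> snd) has_sum s) (Sigma T (\<lambda>t. {x \<in> S. g x = t}))"
    using assms(1) has_sum_reindex[OF inj, of f s] by simp
qed (use assms(3) in simp)

lemma has_sum_finite_fibers:
  fixes f :: "'x \<Rightarrow> 'b::{topological_comm_monoid_add, t3_space}"
  assumes "(f has_sum s) S" and "g ` S \<subseteq> T"
    and "\<And>t. t \<in> T \<Longrightarrow> finite {x \<in> S. g x = t}"
    and "\<And>t. t \<in> T \<Longrightarrow> (\<Sum>x | x \<in> S \<and> g x = t. f x) = h t"
  shows "(h has_sum s) T"
  by (rule has_sum_fibers[OF assms(1,2)]) (auto intro: has_sum_finiteI simp: assms(3,4))

lemma freely_summable_onD:
  "freely_summable_on f S \<Longrightarrow> T \<subseteq> S \<Longrightarrow> (f has_sum infsum f T) T"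
  by (simp add: freely_summable_on_def)

text \<open>\<open>sums_insertable\<close> speaks of sequences only. A family over a subset of a
  countable type becomes a sequence along \<open>to_nat\<close>, extended by 0; the added terms
  vanish by \<open>zero\<close>.\<close>

lemma sums_insertable_has_sum:
  fixes f :: "'i::countable \<Rightarrow> 'a::{comm_monoid_add, t2_space}"
  assumes ins: "sums_insertable \<phi>" and zero: "\<phi> (us @ 0 # vs) = 0" and f: "(f has_sum s) X"
  shows "((\<lambda>i. \<phi> (us @ f i # vs)) has_sum \<phi> (us @ s # vs)) X"
proof -
  define g where "g n = (if n \<in> to_nat ` X then f (from_nat n) else 0)" for n
  have inj: "inj_on to_nat X" by (simp add: inj_on_def)
  have "((g \<circ> to_nat) has_sum s) X"
    using f by (rule has_sum_cong[THEN iffD1, rotated]) (simp add: g_def)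
  then have "(g has_sum s) (to_nat ` X)"
    by (simp only: has_sum_reindex[OF inj])
  then have "(g has_sum s) UNIV"
    by (rule has_sum_cong_neutral[THEN iffD1, rotated -1]) (auto simp: g_def)
  then have "((\<lambda>n. \<phi> (us @ g n # vs)) has_sum \<phi> (us @ s # vs)) UNIV"
    using ins by (simp add: sums_insertable_def)
  then have "((\<lambda>n. \<phi> (us @ g n # vs)) has_sum \<phi> (us @ s # vs)) (to_nat ` X)"
    by (rule has_sum_cong_neutral[THEN iffD1, rotated -1]) (auto simp: g_def zero)
  then have "(((\<lambda>n. \<phi> (us @ g n # vs)) \<circ> to_nat) has_sum \<phi> (us @ s # vs)) X"
    by (simp only: has_sum_reindex[OF inj])
  then show ?thesis
    by (rule has_sum_cong[THEN iffD1, rotated]) (simp add: g_def)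
qed

text \<open>A variable target with scaling \<open>s2\<close> lets one argument serve both the
  operations m and the scalar-valued \<open>\<alpha> 0 xs (one A)\<close>.\<close>

definition multilinear ::
  "('k::field \<Rightarrow> 'a::ab_group_add \<Rightarrow> 'a) \<Rightarrow> ('k \<Rightarrow> 'b::ab_group_add \<Rightarrow> 'b) \<Rightarrow> ('a list \<Rightarrow> 'b) \<Rightarrow> bool"
  where "multilinear s1 s2 \<phi> \<longleftrightarrow> (\<forall>us vs. Vector_Spaces.linear s1 s2 (\<lambda>x. \<phi> (us @ x # vs)))"

context
  fixes s1 :: "'k::field \<Rightarrow> 'a::ab_group_add \<Rightarrow> 'a" and s2 :: "'k \<Rightarrow> 'b::ab_group_add \<Rightarrow> 'b" and \<phi>
  assumes ml: "multilinear s1 s2 \<phi>"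
begin

lemma multilinear_hom: "module_hom s1 s2 (\<lambda>x. \<phi> (us @ x # vs))"
  using ml by (simp add: multilinear_def Vector_Spaces.linear_def)

lemma multilinear_zero: "\<phi> (us @ 0 # vs) = 0"
  by (rule module_hom.zero[OF multilinear_hom])

lemma multilinear_add: "\<phi> (us @ (x + y) # vs) = \<phi> (us @ x # vs) + \<phi> (us @ y # vs)"
  by (rule module_hom.add[OF multilinear_hom])

lemma multilinear_scale: "\<phi> (us @ s1 r x # vs) = s2 r (\<phi> (us @ x # vs))"
  by (rule module_hom.scale[OF multilinear_hom])

lemma multilinear_sum: "\<phi> (us @ (\<Sum>i\<in>I. f i) # vs) = (\<Sum>i\<in>I. \<phi> (us @ f i # vs))"
  by (induction I rule: infinite_finite_induct) (simp_all add: multilinear_zero multilinear_add)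

lemma multilinear_zero_mem: "0 \<in> set xs \<Longrightarrow> \<phi> xs = 0"
  using multilinear_zero by (metis split_list)

text \<open>Induction moves the expanded letters into the prefix \<open>us\<close>. The case in view
  is t = 1, where a(1) is the sum of the coefficients of a(t).\<close>

lemma multilinear_expand:
  "\<phi> (us @ replicate n (\<Sum>i\<le>D. f i)) =
     (\<Sum>u | set u \<subseteq> {..D} \<and> length u = n. \<phi> (us @ map f u))"
proof (induction n arbitrary: us)
  case 0
  have "{u. set u \<subseteq> {..D} \<and> length u = 0} = {[]}" by auto
  then show ?case by simp
next
  case (Suc n)
  let ?L = "\<lambda>n. {u. set u \<subseteq> {..D} \<and> length u = n}"
  have "?L (Suc n) = (\<lambda>(i, u). i # u) ` ({..D} \<times> ?L n)"
    by (auto simp: length_Suc_conv image_iff)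
  moreover have "inj_on (\<lambda>(i, u). i # u) ({..D} \<times> ?L n)"
    by (auto simp: inj_on_def)
  ultimately have "(\<Sum>u\<in>?L (Suc n). \<phi> (us @ map f u)) =
      (\<Sum>(i, u)\<in>{..D} \<times> ?L n. \<phi> (us @ f i # map f u))"
    by (simp add: sum.reindex case_prod_unfold)
  also have "\<dots> = (\<Sum>i\<le>D. \<Sum>u\<in>?L n. \<phi> ((us @ [f i]) @ map f u))"
    by (simp add: sum.cartesian_product)
  also have "\<dots> = (\<Sum>i\<le>D. \<phi> (us @ f i # replicate n (\<Sum>i\<le>D. f i)))"
    by (simp only: Suc[symmetric]) simp
  finally show ?case by (simp add: multilinear_sum)
qed

end

section \<open>Words with one marked letter\<close>

text \<open>
  A word in the coefficients of \<open>a(t)\<close> and \<open>c(t)\<close> is encoded by a list of pairs: \<open>(False, i)\<close> stands for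
  $a_i$ and \<open>(True, j)\<close> for $c_j$.
\<close>

definition letter :: "'a::zero poly \<Rightarrow> 'a poly \<Rightarrow> bool \<times> nat \<Rightarrow> 'a" where
  "letter a c l = coeff (if fst l then c else a) (snd l)"

text \<open>The power of t that belongs to the word.\<close>

definition weight :: "(bool \<times> nat) list \<Rightarrow> nat" where
  "weight X = sum_list (map snd X)"

text \<open>As a_i has shifted degree 0 and c_j shifted degree -1, this is minus the shifted degree
  of a word without zero letters; its parity gives the signs.\<close>

definition marks :: "(bool \<times> nat) list \<Rightarrow> nat" where
  "marks X = length (filter fst X)"

abbreviation unmarked :: "nat list \<Rightarrow> (bool \<times> nat) list" where
  "unmarked \<equiv> map (Pair False)"

text \<open>The length is fixed as well because a_0 has weight 0, so that the weight alone would
  leave infinitely many words.\<close>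

definition marked_words :: "nat \<Rightarrow> nat \<Rightarrow> (bool \<times> nat) list set" where
  "marked_words n M = {X. length X = n \<and> weight X = M \<and> marks X = 1}"

text \<open>The blocks \<open>y\<close> to which one operation m can be applied inside a
  word.\<close>

definition splits :: "'x list \<Rightarrow> ('x list \<times> 'x list \<times> 'x list) set" where
  "splits X = {(x, y, z). x @ y @ z = X \<and> y \<noteq> []}"

lemma weight_simps [simp]:
  "weight [] = 0" "weight (l # X) = snd l + weight X" "weight (X @ Y) = weight X + weight Y"
  "weight (unmarked u) = sum_list u"
  by (simp_all add: weight_def comp_def)

lemma marks_simps [simp]:
  "marks [] = 0" "marks (l # X) = (if fst l then 1 else 0) + marks X"
  "marks (X @ Y) = marks X + marks Y" "marks (unmarked u) = 0"
  by (simp_all add: marks_def comp_def)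

lemma letter_simps [simp]:
  "letter a c (True, j) = coeff c j"
  "letter a c (False, j) = coeff a j"
  by (simp_all add: letter_def)

lemma letter_unmarked [simp]: "letter a c \<circ> Pair False = coeff a"
  by (simp add: fun_eq_iff)

lemma marks_eq_0E:
  assumes "marks X = 0" obtains u where "X = unmarked u"
proof
  show "X = unmarked (map snd X)"
    using assms by (induction X) (auto split: if_splits)
qed

lemma marks_eq_1E:
  assumes "marks X = 1" obtains u j v where "X = unmarked u @ (True, j) # unmarked v"
proof -
  have "\<exists>u j v. X = unmarked u @ (True, j) # unmarked v"
    using assms
  proof (induction X)
    case (Cons l X)
    show ?case
    proof (cases "fst l")
      case True
      with Cons.prems have "marks X = 0" by simp
      then obtain v where "X = unmarked v" by (rule marks_eq_0E)
      with True have "l # X = unmarked [] @ (True, snd l) # unmarked v"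
        by (cases l) auto
      then show ?thesis by blast
    next
      case False
      with Cons obtain u j v where "X = unmarked u @ (True, j) # unmarked v" by auto
      with False have "l # X = unmarked (snd l # u) @ (True, j) # unmarked v"
        by (cases l) auto
      then show ?thesis by blast
    qed
  qed simp
  with that show thesis by blast
qed

lemma unmarked_inj [simp]: "unmarked u = unmarked v \<longleftrightarrow> u = v"
  by (simp add: inj_map_eq_map inj_on_def)

lemma one_mark_inj [simp]:
  "unmarked u @ (True, j) # unmarked v = unmarked u' @ (True, j') # unmarked v' \<longleftrightarrow>
     u = u' \<and> j = j' \<and> v = v'"
proof (induction u arbitrary: u')
  case Nil
  then show ?case by (cases u') auto
next
  case (Cons i u)
  then show ?case by (cases u') auto
qed

lemma finite_words_bounded: "finite {X :: (bool \<times> nat) list. length X = n \<and> weight X \<le> M}"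
proof (rule finite_subset)
  show "{X. length X = n \<and> weight X \<le> M} \<subseteq> {X. set X \<subseteq> UNIV \<times> {..M} \<and> length X = n}"
  proof clarsimp
    fix X :: "(bool \<times> nat) list" and b i
    assume "weight X \<le> M" "(b, i) \<in> set X"
    then have "i \<in> set (map snd X)" by force
    then have "i \<le> weight X" unfolding weight_def by (rule member_le_sum_list) simp
    with \<open>weight X \<le> M\<close> show "i \<le> M" by simp
  qed
  show "finite {X :: (bool \<times> nat) list. set X \<subseteq> UNIV \<times> {..M} \<and> length X = n}"
    by (intro finite_lists_length_eq) auto
qed

lemma finite_marked_words [simp]: "finite (marked_words n M)"
  by (rule finite_subset[OF _ finite_words_bounded[of n M]]) (auto simp: marked_words_def)

text \<open>Passes from positions and block lengths, which index the A-infinity relations and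
  \<open>hoch_b\<close>, to the blocks themselves.\<close>

lemma sum_blocks_eq_splits:
  "(\<Sum>(i, j) \<in> {(i, j). 1 \<le> j \<and> i + j \<le> length X}.
      f (take i X) (take j (drop i X)) (drop (i + j) X)) = (\<Sum>(x, y, z) \<in> splits X. f x y z)"
proof (rule sum.reindex_bij_witness[where i = "\<lambda>(x, y, z). (length x, length y)"
      and j = "\<lambda>(i, j). (take i X, take j (drop i X), drop (i + j) X)"])
  fix p assume "p \<in> {(i, j). 1 \<le> j \<and> i + j \<le> length X}"
  moreover have "take i X @ take j (drop i X) @ drop (i + j) X = X" for i j
    by (metis append_take_drop_id drop_drop add.commute)
  ultimately show "(case p of (i, j) \<Rightarrow> (take i X, take j (drop i X), drop (i + j) X)) \<in> splits X"
    by (auto simp: splits_def)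
qed (auto simp: splits_def Suc_le_eq min_def)

lemma finite_splits [simp]: "finite (splits X)"
proof (rule finite_subset)
  show "splits X \<subseteq> (\<lambda>(i, j). (take i X, take j (drop i X), drop (i + j) X)) `
      ({..length X} \<times> {..length X})"
  proof
    fix p assume "p \<in> splits X"
    then obtain x y z where "p = (x, y, z)" "X = x @ y @ z"
      by (auto simp: splits_def)
    then show "p \<in> (\<lambda>(i, j). (take i X, take j (drop i X), drop (i + j) X)) `
        ({..length X} \<times> {..length X})"
      by (intro image_eqI[of _ _ "(length x, length y)"]) auto
  qed
qed auto

section \<open>Differentiation along a gauge path\<close>

text \<open>For fixed outer data \<open>t\<close> the sum over \<open>R t\<close> can be carried out
  inside one slot of \<open>\<phi>\<close>, where it is 0, so each fiber contributes 0. In the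
  applications \<open>f\<close> is a family from the Maurer-Cartan equation.\<close>

lemma has_sum_zero_inner:
  fixes \<phi> :: "'a::{ab_group_add, t2_space} list \<Rightarrow> 'b::{topological_ab_group_add, t3_space}"
    and f :: "'x::countable \<Rightarrow> 'a"
  assumes ins: "sums_insertable \<phi>" and zero: "\<And>us vs. \<phi> (us @ 0 # vs) = 0"
    and sum: "(F has_sum S) X" and sub: "g ` X \<subseteq> T"
    and fib: "\<And>t. t \<in> T \<Longrightarrow> {x \<in> X. g x = t} = h t ` R t \<and> inj_on (h t) (R t) \<and>
      (f has_sum 0) (R t) \<and> (\<forall>r\<in>R t. F (h t r) = \<phi> (us t @ f r # vs t))"
  shows "S = 0"
proof -
  have "((\<lambda>t. 0) has_sum S) T"
  proof (rule has_sum_fibers[OF sum sub])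
    fix t assume t: "t \<in> T"
    have "((\<lambda>r. \<phi> (us t @ f r # vs t)) has_sum \<phi> (us t @ 0 # vs t)) (R t)"
      by (rule sums_insertable_has_sum[OF ins zero]) (use fib[OF t] in blast)
    then have "((F \<circ> h t) has_sum 0) (R t)"
      unfolding zero by (rule has_sum_cong[THEN iffD1, rotated]) (use fib[OF t] in auto)
    then show "(F has_sum 0) {x \<in> X. g x = t}"
      using fib[OF t] by (simp only: has_sum_reindex)
  qed
  then show ?thesis
    using has_sum_unique has_sum_0_simp by blast
qed

text \<open>
  The sum over the marked words of fixed length is finite, so the cancellations that make the
  signed block sums vanish involve no infinite sums.
\<close>

lemma marked_block_sums_zero:
  fixes A :: "('k::field_char_0, 'a::{topological_ab_group_add, t3_space}) ainf"
    and \<phi> :: "'a list \<Rightarrow> 'b::{topological_ab_group_add, t3_space}"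
  assumes ml: "multilinear (smul A) sc \<phi>" and ins: "sums_insertable \<phi>"
    and vs: "vector_space sc"
    and ok: "path_sums_ok A \<phi> a c"
    and rel: "\<And>n. (\<Sum>X\<in>marked_words n M. \<Sum>(x, y, z)\<in>splits X. sc ((- 1) ^ marks x)
        (\<phi> (map (letter a c) x @ mul A (map (letter a c) y) # map (letter a c) z))) = 0"
    and mc: "\<And>d. d \<le> M \<Longrightarrow>
        ((\<lambda>r. mul A (map (coeff a) r)) has_sum 0) {r. r \<noteq> [] \<and> sum_list r = d}"
  shows "((\<lambda>(u, r, j, s, v).
        \<phi> (map (coeff a) u @ mul A (map (coeff a) r @ coeff c j # map (coeff a) s) # map (coeff a) v))
      has_sum 0) {(u, r, j, s, v). sum_list u + sum_list r + j + sum_list s + sum_list v = M}"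
proof -
  interpret sc: vector_space sc by (rule vs)
  let ?w = "map (coeff a)" and ?e = "map (letter a c)"
  note zero = multilinear_zero[OF ml]
  \<comment> \<open>\<open>T\<close> indexes all insertions of one operation into words with one c.
    The letter c lies inside the block in \<open>F0\<close>, after it in \<open>F1\<close> and
    before it in \<open>F2\<close>.\<close>
  define T where "T = {(x, y, z). y \<noteq> [] \<and> marks (x @ y @ z) = 1 \<and> weight (x @ y @ z) = M}"
  define \<Xi> where "\<Xi> = (\<lambda>(x, y, z). sc ((- 1) ^ marks x) (\<phi> (?e x @ mul A (?e y) # ?e z)))"
  define F0 where "F0 = {(u, r, j, s, v). sum_list u + sum_list r + j + sum_list s + sum_list v = M}"
  define F1 where "F1 = {(u, r, s, j, v). r \<noteq> [] \<and>
      sum_list u + sum_list r + sum_list s + j + sum_list v = M}"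
  define F2 where "F2 = {(u, j, s, r, v). r \<noteq> [] \<and>
      sum_list u + j + sum_list s + sum_list r + sum_list v = M}"
  define f0 where "f0 = (\<lambda>(u, r, j, s, v). \<phi> (?w u @ mul A (?w r @ coeff c j # ?w s) # ?w v))"
  define f1 where "f1 = (\<lambda>(u, r, s, j, v). \<phi> (?w u @ mul A (?w r) # ?w s @ coeff c j # ?w v))"
  define f2 where "f2 = (\<lambda>(u, j, s, r, v). \<phi> (?w u @ coeff c j # ?w s @ mul A (?w r) # ?w v))"
  define h0 where "h0 = (\<lambda>(u, r, j, s, v).
      (unmarked u, unmarked r @ (True, j) # unmarked s, unmarked v))"
  define h1 where "h1 = (\<lambda>(u, r, s, j, v).
      (unmarked u, unmarked r, unmarked s @ (True, j) # unmarked v))"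
  define h2 where "h2 = (\<lambda>(u, j, s, r, v).
      (unmarked u @ (True, j) # unmarked s, unmarked r, unmarked v))"
  have free: "freely_summable_on f0 UNIV" "freely_summable_on f1 {(u, r, s, j, v). r \<noteq> []}"
      "freely_summable_on f2 {(u, j, s, r, v). r \<noteq> []}"
    using ok by (simp_all add: path_sums_ok_def Let_def f0_def f1_def f2_def)
  obtain S0 S1 S2 where S0: "(f0 has_sum S0) F0" and S1: "(f1 has_sum S1) F1"
      and S2: "(f2 has_sum S2) F2"
    using freely_summable_onD[OF free(1), of F0] freely_summable_onD[OF free(2), of F1]
      freely_summable_onD[OF free(3), of F2] by (fastforce simp: F1_def F2_def)

  \<comment> \<open>With everything but the block \<open>r\<close> fixed, \<open>r\<close> runs over
    the nonempty words of one weight at most \<open>M\<close>, so \<open>mc\<close> makes the inner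
    sum 0. The same works for \<open>S2\<close>.\<close>
  have "S1 = 0"
  proof (rule has_sum_zero_inner[OF ins zero S1, where f = "\<lambda>r. mul A (?w r)"
        and g = "\<lambda>(u, r, s, j, v). (u, s, j, v)"
        and T = "{(u, s, j, v). sum_list u + sum_list s + j + sum_list v \<le> M}"
        and h = "\<lambda>(u, s, j, v) r. (u, r, s, j, v)"
        and R = "\<lambda>(u, s, j, v). {r. r \<noteq> [] \<and> sum_list r = M - (sum_list u + sum_list s + j + sum_list v)}"
        and us = "\<lambda>(u, s, j, v). ?w u" and vs = "\<lambda>(u, s, j, v). ?w s @ coeff c j # ?w v"])
    fix t assume "t \<in> {(u, s, j, v). sum_list u + sum_list s + j + sum_list v \<le> M}"
    then obtain u s j v where t: "t = (u, s, j, v)" "sum_list u + sum_list s + j + sum_list v \<le> M"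
      by auto
    then show "{x \<in> F1. (case x of (u, r, s, j, v) \<Rightarrow> (u, s, j, v)) = t} =
        (case t of (u, s, j, v) \<Rightarrow> \<lambda>r. (u, r, s, j, v)) ` (case t of (u, s, j, v) \<Rightarrow>
          {r. r \<noteq> [] \<and> sum_list r = M - (sum_list u + sum_list s + j + sum_list v)}) \<and>
      inj_on (case t of (u, s, j, v) \<Rightarrow> \<lambda>r. (u, r, s, j, v)) (case t of (u, s, j, v) \<Rightarrow>
          {r. r \<noteq> [] \<and> sum_list r = M - (sum_list u + sum_list s + j + sum_list v)}) \<and>
      ((\<lambda>r. mul A (?w r)) has_sum 0) (case t of (u, s, j, v) \<Rightarrow>
          {r. r \<noteq> [] \<and> sum_list r = M - (sum_list u + sum_list s + j + sum_list v)}) \<and>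
      (\<forall>r\<in>case t of (u, s, j, v) \<Rightarrow>
          {r. r \<noteq> [] \<and> sum_list r = M - (sum_list u + sum_list s + j + sum_list v)}.
        f1 ((case t of (u, s, j, v) \<Rightarrow> \<lambda>r. (u, r, s, j, v)) r) =
        \<phi> ((case t of (u, s, j, v) \<Rightarrow> ?w u) @ mul A (?w r) #
          (case t of (u, s, j, v) \<Rightarrow> ?w s @ coeff c j # ?w v)))"
      using mc by (auto simp: F1_def f1_def inj_on_def)
  qed (auto simp: F1_def)

  have "S2 = 0"
  proof (rule has_sum_zero_inner[OF ins zero S2, where f = "\<lambda>r. mul A (?w r)"
        and g = "\<lambda>(u, j, s, r, v). (u, j, s, v)"
        and T = "{(u, j, s, v). sum_list u + j + sum_list s + sum_list v \<le> M}"
        and h = "\<lambda>(u, j, s, v) r. (u, j, s, r, v)"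
        and R = "\<lambda>(u, j, s, v). {r. r \<noteq> [] \<and> sum_list r = M - (sum_list u + j + sum_list s + sum_list v)}"
        and us = "\<lambda>(u, j, s, v). ?w u @ coeff c j # ?w s" and vs = "\<lambda>(u, j, s, v). ?w v"])
    fix t assume "t \<in> {(u, j, s, v). sum_list u + j + sum_list s + sum_list v \<le> M}"
    then obtain u j s v where t: "t = (u, j, s, v)" "sum_list u + j + sum_list s + sum_list v \<le> M"
      by auto
    then show "{x \<in> F2. (case x of (u, j, s, r, v) \<Rightarrow> (u, j, s, v)) = t} =
        (case t of (u, j, s, v) \<Rightarrow> \<lambda>r. (u, j, s, r, v)) ` (case t of (u, j, s, v) \<Rightarrow>
          {r. r \<noteq> [] \<and> sum_list r = M - (sum_list u + j + sum_list s + sum_list v)}) \<and>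
      inj_on (case t of (u, j, s, v) \<Rightarrow> \<lambda>r. (u, j, s, r, v)) (case t of (u, j, s, v) \<Rightarrow>
          {r. r \<noteq> [] \<and> sum_list r = M - (sum_list u + j + sum_list s + sum_list v)}) \<and>
      ((\<lambda>r. mul A (?w r)) has_sum 0) (case t of (u, j, s, v) \<Rightarrow>
          {r. r \<noteq> [] \<and> sum_list r = M - (sum_list u + j + sum_list s + sum_list v)}) \<and>
      (\<forall>r\<in>case t of (u, j, s, v) \<Rightarrow>
          {r. r \<noteq> [] \<and> sum_list r = M - (sum_list u + j + sum_list s + sum_list v)}.
        f2 ((case t of (u, j, s, v) \<Rightarrow> \<lambda>r. (u, j, s, r, v)) r) =
        \<phi> ((case t of (u, j, s, v) \<Rightarrow> ?w u @ coeff c j # ?w s) @ mul A (?w r) #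
          (case t of (u, j, s, v) \<Rightarrow> ?w v)))"
      using mc by (auto simp: F2_def f2_def inj_on_def)
  qed (auto simp: F2_def)

  have T_eq: "T = h0 ` F0 \<union> (h1 ` F1 \<union> h2 ` F2)"
  proof (intro equalityI subsetI)
    fix p assume "p \<in> T"
    then obtain x y z where p: "p = (x, y, z)" "y \<noteq> []" "marks x + marks y + marks z = 1"
        "weight x + weight y + weight z = M"
      by (auto simp: T_def)
    from p(3) consider "marks x = 0" "marks y = 1" "marks z = 0"
      | "marks x = 0" "marks y = 0" "marks z = 1" | "marks x = 1" "marks y = 0" "marks z = 0"
      by linarith
    then show "p \<in> h0 ` F0 \<union> (h1 ` F1 \<union> h2 ` F2)"
    proof cases
      case 1
      then obtain u r j s v where
        "x = unmarked u" "y = unmarked r @ (True, j) # unmarked s" "z = unmarked v"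
        by (metis marks_eq_0E marks_eq_1E)
      with p have "p = h0 (u, r, j, s, v)" "(u, r, j, s, v) \<in> F0"
        by (auto simp: h0_def F0_def)
      then show ?thesis by blast
    next
      case 2
      then obtain u r j s v where
        "x = unmarked u" "y = unmarked r" "z = unmarked s @ (True, j) # unmarked v"
        by (metis marks_eq_0E marks_eq_1E)
      with p have "p = h1 (u, r, s, j, v)" "(u, r, s, j, v) \<in> F1"
        by (auto simp: h1_def F1_def)
      then show ?thesis by blast
    next
      case 3
      then obtain u r j s v where
        "x = unmarked u @ (True, j) # unmarked s" "y = unmarked r" "z = unmarked v"
        by (metis marks_eq_0E marks_eq_1E)
      with p have "p = h2 (u, j, s, r, v)" "(u, j, s, r, v) \<in> F2"
        by (auto simp: h2_def F2_def)
      then show ?thesis by blast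
    qed
  qed (auto simp: T_def F0_def F1_def F2_def h0_def h1_def h2_def)

  have "((\<Xi> \<circ> h0) has_sum S0) F0"
    using S0 by (rule has_sum_cong[THEN iffD1, rotated]) (auto simp: \<Xi>_def h0_def f0_def)
  moreover have "inj_on h0 F0" by (auto simp: inj_on_def h0_def)
  ultimately have X0: "(\<Xi> has_sum S0) (h0 ` F0)" by (simp only: has_sum_reindex)
  have "((\<Xi> \<circ> h1) has_sum S1) F1"
    using S1 by (rule has_sum_cong[THEN iffD1, rotated]) (auto simp: \<Xi>_def h1_def f1_def)
  moreover have "inj_on h1 F1" by (auto simp: inj_on_def h1_def)
  ultimately have X1: "(\<Xi> has_sum S1) (h1 ` F1)" by (simp only: has_sum_reindex)
  \<comment> \<open>Only in this family does the mark lie in \<open>x\<close>, which makes the sign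
    -1.\<close>
  have "((\<lambda>p. - f2 p) has_sum - S2) F2"
    using S2 by (simp add: has_sum_uminus)
  then have "((\<Xi> \<circ> h2) has_sum - S2) F2"
    by (rule has_sum_cong[THEN iffD1, rotated]) (auto simp: \<Xi>_def h2_def f2_def)
  moreover have "inj_on h2 F2" by (auto simp: inj_on_def h2_def)
  ultimately have X2: "(\<Xi> has_sum - S2) (h2 ` F2)" by (simp only: has_sum_reindex)

  have "h1 ` F1 \<inter> h2 ` F2 = {}"
    by (auto simp: h1_def h2_def dest!: arg_cong[of _ _ marks])
  moreover have "h0 ` F0 \<inter> (h1 ` F1 \<union> h2 ` F2) = {}"
    by (auto simp: h0_def h1_def h2_def dest!: arg_cong[of _ _ marks])
  ultimately have "(\<Xi> has_sum S0 + (S1 + - S2)) T"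
    unfolding T_eq by (intro has_sum_Un_disjoint X0 X1 X2)
  then have T_sum: "(\<Xi> has_sum S0) T"
    by (simp add: \<open>S1 = 0\<close> \<open>S2 = 0\<close>)

  have "((\<lambda>n. 0) has_sum S0) (UNIV :: nat set)"
  proof (rule has_sum_finite_fibers[OF T_sum, where g = "\<lambda>(x, y, z). length (x @ y @ z)"])
    fix n
    have eq: "{p \<in> T. (case p of (x, y, z) \<Rightarrow> length (x @ y @ z)) = n} =
        snd ` (SIGMA X:marked_words n M. splits X)"
      by (force simp: T_def marked_words_def splits_def)
    then show "finite {p \<in> T. (case p of (x, y, z) \<Rightarrow> length (x @ y @ z)) = n}" by simp
    have inj: "inj_on snd (SIGMA X:marked_words n M. splits X)"
      by (auto simp: inj_on_def splits_def)
    show "(\<Sum>p | p \<in> T \<and> (case p of (x, y, z) \<Rightarrow> length (x @ y @ z)) = n. \<Xi> p) = 0"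
      unfolding eq sum.reindex[OF inj] using rel[of n]
      by (subst (asm) sum.Sigma) (auto simp: case_prod_unfold comp_def \<Xi>_def)
  qed auto
  then have "S0 = 0"
    using has_sum_unique has_sum_0_simp by blast
  then show ?thesis
    using S0 by (simp add: F0_def f0_def)
qed

section \<open>The Leibniz rule and the gauge equation in coefficients\<close>

lemma finite_lists_sum: "finite {u :: nat list. length u = n \<and> sum_list u = N}"
proof (rule finite_subset)
  show "{u. length u = n \<and> sum_list u = N} \<subseteq> {u. set u \<subseteq> {..N} \<and> length u = n}"
    using member_le_sum_list by fastforce
  show "finite {u. set u \<subseteq> {..N} \<and> length u = n}"
    by (intro finite_lists_length_eq) auto
qed

text \<open>The Leibniz rule for t^N with N = \<open>sum_list U\<close>: differentiating the letter
  a_k gives a factor k. Letters with k = 0 contribute nothing, hence \<open>Suc d\<close>.\<close>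

lemma finite_positions_sum:
  "finite {(u, d, v). u @ Suc d # v = U} \<and>
   (\<Sum>(u, d, v) | u @ Suc d # v = U. Suc d) = sum_list U"
proof (induction U)
  case (Cons x U)
  let ?D = "\<lambda>U. {(u, d, v). u @ Suc d # v = U}"
  let ?c = "\<lambda>(u, d :: nat, v :: nat list). (x # u, d, v)"
  let ?E = "if x = 0 then {} else {([] :: nat list, x - 1, U)}"
  have eq: "?D (x # U) = ?E \<union> ?c ` ?D U"
  proof (intro equalityI subsetI)
    fix p assume "p \<in> ?D (x # U)"
    then obtain u d v where "p = (u, d, v)" "u @ Suc d # v = x # U" by auto
    then show "p \<in> ?E \<union> ?c ` ?D U" by (cases u) (auto simp: image_iff)
  qed (auto split: if_splits)
  have inj: "inj_on ?c (?D U)"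
    by (auto simp: inj_on_def)
  have "(\<Sum>(u, d, v)\<in>?D (x # U). Suc d) = (\<Sum>(u, d, v)\<in>?E. Suc d) + (\<Sum>(u, d, v)\<in>?c ` ?D U. Suc d)"
    unfolding eq by (rule sum.union_disjoint) (use Cons.IH in auto)
  also have "(\<Sum>(u, d, v)\<in>?c ` ?D U. Suc d) = (\<Sum>(u, d, v)\<in>?D U. Suc d)"
    by (subst sum.reindex[OF inj]) (simp add: case_prod_unfold)
  also have "\<dots> = sum_list U" using Cons.IH by simp
  finally have "(\<Sum>(u, d, v)\<in>?D (x # U). Suc d) = sum_list (x # U)" by simp
  moreover have "finite (?D (x # U))" unfolding eq using Cons.IH by simp
  ultimately show ?case by simp
qed simp

lemma mul_coeff_path:
  fixes A :: "('k, 'a::ab_group_add) ainf"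
  defines "Q \<equiv> \<lambda>p q N. {(r, j, s). length r = p \<and> length s = q \<and> sum_list r + j + sum_list s = N}"
  shows "mul_coeff A (replicate p a @ c # replicate q a) N =
      (\<Sum>(r, j, s)\<in>Q p q N. mul A (map (coeff a) r @ coeff c j # map (coeff a) s))"
    and "finite (Q p q N)"
proof -
  have eq: "(\<lambda>(r, j, s). r @ j # s) ` Q p q N =
      {u. length u = length (replicate p a @ c # replicate q a) \<and> sum_list u = N}" (is "?f ` _ = ?R")
  proof (intro equalityI subsetI)
    fix u assume u: "u \<in> ?R"
    then have "u = take p u @ u ! p # drop (Suc p) u"
      by (simp add: id_take_nth_drop)
    with u show "u \<in> ?f ` Q p q N"
      by (intro image_eqI[of _ _ "(take p u, u ! p, drop (Suc p) u)"])
        (auto simp: Q_def, metis sum_list.Cons sum_list.append add.assoc)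
  qed (auto simp: Q_def)
  have inj: "inj_on ?f (Q p q N)"
    by (auto simp: inj_on_def Q_def)
  show "finite (Q p q N)"
    using finite_imageD[OF _ inj] eq finite_lists_sum by simp
  show "mul_coeff A (replicate p a @ c # replicate q a) N =
      (\<Sum>(r, j, s)\<in>Q p q N. mul A (map (coeff a) r @ coeff c j # map (coeff a) s))"
    unfolding mul_coeff_def eq[symmetric] sum.reindex[OF inj]
    by (intro sum.cong refl) (auto simp: Q_def zip_replicate1 comp_def)
qed

text \<open>A natural factor is a repeated addition; scaling is not assumed continuous.\<close>

lemma has_sum_scale_of_nat:
  fixes f :: "'x \<Rightarrow> 'b::topological_ab_group_add"
  assumes "vector_space sc" and "(f has_sum s) X"
  shows "((\<lambda>x. sc (of_nat n) (f x)) has_sum sc (of_nat n) s) X"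
proof -
  interpret vector_space sc by fact
  show ?thesis
    by (induction n) (simp_all add: scale_left_distrib has_sum_add assms(2))
qed

text \<open>The gauge equation sums the operations containing c to (d+1) a_(d+1). The vanishing
  total of \<open>marked_block_sums_zero\<close> is therefore the t^M coefficient of the derivative,
  which is M+1 times the sum in question.\<close>

lemma gauge_derivative_zero:
  fixes A :: "('k::field_char_0, 'a::{topological_ab_group_add, t3_space}) ainf"
    and \<phi> :: "'a list \<Rightarrow> 'b::{topological_ab_group_add, t3_space}"
  assumes ml: "multilinear (smul A) sc \<phi>" and ins: "sums_insertable \<phi>"
    and vs: "vector_space sc"
    and ok: "path_sums_ok A \<phi> a c" and path: "gauge_path A a c"
    and rel: "\<And>n. (\<Sum>X\<in>marked_words n M. \<Sum>(x, y, z)\<in>splits X. sc ((- 1) ^ marks x)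
        (\<phi> (map (letter a c) x @ mul A (map (letter a c) y) # map (letter a c) z))) = 0"
    and mc: "\<And>d. d \<le> M \<Longrightarrow>
        ((\<lambda>r. mul A (map (coeff a) r)) has_sum 0) {r. r \<noteq> [] \<and> sum_list r = d}"
  shows "((\<lambda>u. \<phi> (map (coeff a) u)) has_sum 0) {u. sum_list u = Suc M}"
proof -
  interpret sc: vector_space sc by (rule vs)
  let ?w = "map (coeff a)"
  note zero = multilinear_zero[OF ml]
  define F where "F = {(u, r, j, s, v). sum_list u + sum_list r + j + sum_list s + sum_list v = M}"
  define f where "f = (\<lambda>(u, r, j, s, v). \<phi> (?w u @ mul A (?w r @ coeff c j # ?w s) # ?w v))"
  define h where "h = (\<lambda>(u, d, v). sc (of_nat (Suc d)) (\<phi> (?w (u @ Suc d # v))))"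
  define B where "B = {(u, d, v). sum_list u + d + sum_list v = M}"
  have F0: "(f has_sum 0) F"
    unfolding F_def f_def by (rule marked_block_sums_zero[OF ml ins vs ok rel mc])
  have free: "freely_summable_on f UNIV"
    using ok by (simp add: path_sums_ok_def Let_def f_def)

  \<comment> \<open>A fiber fixes the outer words and the total weight \<open>d\<close> of the
    entries of the inserted operation.\<close>
  have "(h has_sum 0) B"
  proof (rule has_sum_fibers[OF F0, where g = "\<lambda>(u, r, j, s, v). (u, sum_list r + j + sum_list s, v)"])
    fix t assume "t \<in> B"
    then obtain u d v where t: "t = (u, d, v)" "sum_list u + d + sum_list v = M"
      by (auto simp: B_def)
    let ?G = "{p \<in> F. (case p of (u, r, j, s, v) \<Rightarrow> (u, sum_list r + j + sum_list s, v)) = t}"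
    have G: "(f has_sum infsum f ?G) ?G"
      using free by (rule freely_summable_onD) simp
    let ?mc = "\<lambda>(p, q). mul_coeff A (replicate p a @ c # replicate q a) d"
    \<comment> \<open>Fixing also the numbers \<open>p\<close> and \<open>q\<close> of letters
      around c leaves finite sums, the coefficients \<open>mul_coeff\<close> of the gauge
      equation.\<close>
    have "((\<lambda>pq. \<phi> (?w u @ ?mc pq # ?w v)) has_sum infsum f ?G) UNIV"
    proof (rule has_sum_finite_fibers[OF G, where g = "\<lambda>(u, r, j, s, v). (length r, length s)"])
      fix pq :: "nat \<times> nat"
      obtain p q where pq: "pq = (p, q)" by fastforce
      let ?Q = "{(r, j, s). length r = p \<and> length s = q \<and> sum_list r + j + sum_list s = d}"
      have eq: "{x \<in> ?G. (case x of (u, r, j, s, v) \<Rightarrow> (length r, length s)) = pq} =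
          (\<lambda>(r, j, s). (u, r, j, s, v)) ` ?Q"
        using t by (auto simp: F_def pq image_iff)
      have inj: "inj_on (\<lambda>(r, j, s). (u, r, j, s, v)) ?Q"
        by (auto simp: inj_on_def)
      show "finite {x \<in> ?G. (case x of (u, r, j, s, v) \<Rightarrow> (length r, length s)) = pq}"
        unfolding eq by (intro finite_imageI mul_coeff_path(2))
      show "(\<Sum>x | x \<in> ?G \<and> (case x of (u, r, j, s, v) \<Rightarrow> (length r, length s)) = pq. f x) =
          \<phi> (?w u @ ?mc pq # ?w v)"
        unfolding eq sum.reindex[OF inj]
        by (simp add: pq mul_coeff_path(1) multilinear_sum[OF ml] f_def case_prod_unfold)
    qed auto
    moreover have "((\<lambda>pq. \<phi> (?w u @ ?mc pq # ?w v)) has_sum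
        \<phi> (?w u @ smul A (of_nat (d + 1)) (coeff a (d + 1)) # ?w v)) UNIV"
      by (rule sums_insertable_has_sum[OF ins zero]) (use path in \<open>simp add: gauge_path_def\<close>)
    ultimately have "infsum f ?G = \<phi> (?w u @ smul A (of_nat (d + 1)) (coeff a (d + 1)) # ?w v)"
      by (rule has_sum_unique)
    also have "\<dots> = h t"
      by (simp add: multilinear_scale[OF ml] h_def t)
    finally show "(f has_sum h t) ?G" using G by simp
  qed (auto simp: F_def B_def)

  \<comment> \<open>The same word \<open>U\<close> arises once for each letter of positive exponent,
    and the factors add up to \<open>Suc M\<close>.\<close>
  then have "((\<lambda>U. sc (of_nat (Suc M)) (\<phi> (?w U))) has_sum 0) {U. sum_list U = Suc M}"
  proof (rule has_sum_finite_fibers[where g = "\<lambda>(u, d, v). u @ Suc d # v"])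
    fix U assume U: "U \<in> {U. sum_list U = Suc M}"
    have eq: "{p \<in> B. (case p of (u, d, v) \<Rightarrow> u @ Suc d # v) = U} = {(u, d, v). u @ Suc d # v = U}"
      using U by (auto simp: B_def)
    show "finite {p \<in> B. (case p of (u, d, v) \<Rightarrow> u @ Suc d # v) = U}"
      unfolding eq using finite_positions_sum by blast
    have "(\<Sum>p | p \<in> B \<and> (case p of (u, d, v) \<Rightarrow> u @ Suc d # v) = U. h p) =
        (\<Sum>(u, d, v) | u @ Suc d # v = U. sc (of_nat (Suc d)) (\<phi> (?w U)))"
      unfolding eq by (intro sum.cong refl) (auto simp: h_def)
    also have "\<dots> = sc (of_nat (\<Sum>(u, d, v) | u @ Suc d # v = U. Suc d)) (\<phi> (?w U))"
      unfolding of_nat_sum sc.scale_sum_left by (simp add: case_prod_unfold del: of_nat_Suc)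
    also have "\<dots> = sc (of_nat (Suc M)) (\<phi> (?w U))"
      using finite_positions_sum[of U] U by simp
    finally show "(\<Sum>p | p \<in> B \<and> (case p of (u, d, v) \<Rightarrow> u @ Suc d # v) = U. h p) =
        sc (of_nat (Suc M)) (\<phi> (?w U))" .
  qed (auto simp: B_def)
  moreover
  have "((\<lambda>u. \<phi> (?w u)) has_sum infsum (\<lambda>u. \<phi> (?w u)) {u. sum_list u = Suc M}) {u. sum_list u = Suc M}"
    (is "(_ has_sum ?H) _")
    by (rule freely_summable_onD[of _ "{u. u \<noteq> []}"])
      (use ok in \<open>auto simp: path_sums_ok_def Let_def\<close>)
  note H = this
  ultimately have "sc (of_nat (Suc M)) ?H = 0"
    using has_sum_scale_of_nat[OF vs H, of "Suc M"] has_sum_unique by blast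
  \<comment> \<open>Characteristic 0 permits division by M+1.\<close>
  then have "?H = 0"
    by (simp del: of_nat_Suc)
  with H show ?thesis by simp
qed

text \<open>Exponents with sum 0 all vanish, so the t^0 part only sees a(0).\<close>

lemma has_sum_weight_zero:
  fixes a :: "'a::zero poly"
  shows "((\<lambda>u. \<phi> (map (coeff a) u)) has_sum s) {u. u \<noteq> [] \<and> sum_list u = 0} \<longleftrightarrow>
    ((\<lambda>k. \<phi> (replicate k (coeff a 0))) has_sum s) {1..}"
proof -
  have "{u. u \<noteq> [] \<and> sum_list u = 0} = (\<lambda>k. replicate k (0::nat)) ` {1..}"
  proof (intro equalityI subsetI)
    fix u :: "nat list" assume "u \<in> {u. u \<noteq> [] \<and> sum_list u = 0}"
    then have "u = replicate (length u) 0" "length u \<ge> 1"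
      by (auto simp: Suc_le_eq intro: replicate_eqI)
    then show "u \<in> (\<lambda>k. replicate k 0) ` {1..}" by blast
  qed auto
  moreover have "inj_on (\<lambda>k. replicate k (0::nat)) {1..}"
    by (auto simp: inj_on_def)
  ultimately show ?thesis
    by (simp add: has_sum_reindex comp_def)
qed

section \<open>Hochschild chains that start with the unit\<close>

lemma minus_one_powi_minus_of_nat: "(- 1 :: 'k::field) powi (- int n) = (- 1) ^ n"
  by (simp add: power_int_minus_left minus_one_power_iff)

lemma sdegs_simps [simp]:
  "sdegs A [] = 0" "sdegs A (x # xs) = sdeg A x + sdegs A xs"
  "sdegs A (xs @ ys) = sdegs A xs + sdegs A ys"
  by (simp_all add: sdegs_def)

text \<open>\<open>deg\<close> is a choice, but two degrees of a nonzero element would give it two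
  homogeneous decompositions. Since 0 has every degree, words with a zero letter are treated
  separately below.\<close>

lemma deg_eqI:
  assumes gvs: "graded_vector_space A" and x: "x \<in> gr A d" "x \<noteq> 0"
  shows "deg A x = d"
proof (rule ccontr)
  interpret vector_space "smul A"
    using gvs by (simp add: graded_vector_space_def)
  have zero: "0 \<in> gr A e" for e
    using gvs by (auto simp: graded_vector_space_def subspace_def)
  define P where "P f \<longleftrightarrow> (\<forall>d. f d \<in> gr A d) \<and> finite {d. f d \<noteq> 0} \<and> x = (\<Sum>d | f d \<noteq> 0. f d)" for f
  have uniq: "\<exists>!f. P f"
    using gvs unfolding P_def graded_vector_space_def by blast
  have dec: "P (\<lambda>i. if i = e then x else 0)" if "x \<in> gr A e" for e
  proof -
    have "{i. (if i = e then x else 0) \<noteq> 0} = {e}" using x by auto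
    with that zero show ?thesis by (auto simp: P_def)
  qed
  assume ne: "deg A x \<noteq> d"
  have "x \<in> gr A (deg A x)"
    unfolding deg_def using x(1) by (rule someI)
  from dec[OF this] dec[OF x(1)] uniq
  have "(\<lambda>i. if i = deg A x then x else 0) = (\<lambda>i. if i = d then x else 0)" by blast
  from fun_cong[OF this, of d] ne x(2) show False by simp
qed

lemma homogeneous_deg: "homogeneous A x \<Longrightarrow> x \<in> gr A (deg A x)"
  unfolding homogeneous_def deg_def by (rule someI_ex)

section \<open>Reduced cochains and their pairing with chains\<close>

lemma reduced_cochain_multilinear:
  "reduced_cochain A \<beta> \<Longrightarrow> multilinear (smul A) (*) (\<lambda>xs. \<beta> xs w)"
  by (simp add: reduced_cochain_def multilinear_def)

lemma reduced_cochain_hom: "reduced_cochain A \<beta> \<Longrightarrow> module_hom (smul A) (*) (\<beta> xs)"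
  by (simp add: reduced_cochain_def Vector_Spaces.linear_def)

lemma reduced_cochain_zero: "reduced_cochain A \<beta> \<Longrightarrow> \<beta> xs 0 = 0"
  by (rule module_hom.zero[OF reduced_cochain_hom])

text \<open>Supports can shrink when chains are added, so additivity is checked on a common finite
  superset.\<close>

lemma pair_chain_superset:
  assumes "finite K" "Poly_Mapping.keys x \<subseteq> K"
  shows "pair_chain A \<beta> x = (\<Sum>t\<in>K. Poly_Mapping.lookup x t * pair_tensor A \<beta> t)"
  unfolding pair_chain_def using assms by (intro sum.mono_neutral_left) (auto simp: in_keys_iff)

lemma pair_chain_add: "pair_chain A \<beta> (x + y) = pair_chain A \<beta> x + pair_chain A \<beta> y"
proof -
  let ?K = "Poly_Mapping.keys x \<union> Poly_Mapping.keys y"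
  have "pair_chain A \<beta> z = (\<Sum>t\<in>?K. Poly_Mapping.lookup z t * pair_tensor A \<beta> t)"
    if "Poly_Mapping.keys z \<subseteq> ?K" for z
    using that by (intro pair_chain_superset) auto
  from this[of x] this[of y] this[of "x + y"] show ?thesis
    by (simp add: Poly_Mapping.keys_add lookup_add distrib_right sum.distrib)
qed

lemma pair_chain_single: "pair_chain A \<beta> (Poly_Mapping.single t r) = r * pair_tensor A \<beta> t"
  by (simp add: pair_chain_def)

lemma pair_chain_sum: "pair_chain A \<beta> (\<Sum>i\<in>I. f i) = (\<Sum>i\<in>I. pair_chain A \<beta> (f i))"
  by (induction I rule: infinite_finite_induct)
    (simp_all add: pair_chain_add, simp_all add: pair_chain_def)

section \<open>Degrees, the unit, and the operators b and B on chains starting with I\<close>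

context
  fixes A :: "('k::{field_char_0}, 'a::{topological_ab_group_add, t3_space}) ainf"
  assumes A: "unital_ainf_algebra A"
begin

lemma unital_ainf: "ainf_algebra A" and strict_unit: "strict_unit A" and mul_insertable: "sums_insertable (mul A)"
  using A unfolding unital_ainf_algebra_def by blast+

lemma ainf_graded: "graded_vector_space A"
  using unital_ainf[unfolded ainf_algebra_def] by (rule conjunct1)

lemma ainf_vector_space: "vector_space (smul A)"
  using ainf_graded[unfolded graded_vector_space_def] by (rule conjunct1)

lemma mul_multilinear: "multilinear (smul A) (smul A) (mul A)"
  unfolding multilinear_def by (rule unital_ainf[unfolded ainf_algebra_def, THEN conjunct2, THEN conjunct1])

lemma one_gr: "one A \<in> gr A 0"
  using strict_unit[unfolded strict_unit_def] by (rule conjunct1)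

lemma smul_gr:
  assumes "x \<in> gr A d"
  shows "smul A r x \<in> gr A d"
proof -
  interpret vector_space "smul A" by (rule ainf_vector_space)
  have "subspace (gr A d)"
    using ainf_graded[unfolded graded_vector_space_def, THEN conjunct2, THEN conjunct1] by (rule spec)
  then show ?thesis using assms by (rule subspace_scale)
qed

lemma mul_gr:
  assumes "xs \<noteq> []" "list_all2 (\<lambda>d x. x \<in> gr A d) ds xs"
  shows "mul A xs \<in> gr A ((\<Sum>d\<leftarrow>ds. d - 1) + 2)"
proof -
  note unital_ainf[unfolded ainf_algebra_def, THEN conjunct2, THEN conjunct2, THEN conjunct1]
  with assms show ?thesis by blast
qed

lemma mul_one_left: "homogeneous A x \<Longrightarrow> mul A [one A, x] = x"
  using strict_unit unfolding strict_unit_def homogeneous_def by blast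

lemma mul_one_right:
  assumes "homogeneous A x"
  shows "mul A [x, one A] = smul A ((- 1) powi deg A x) x"
proof -
  interpret vector_space "smul A" by (rule ainf_vector_space)
  let ?r = "(- 1 :: 'k) powi deg A x"
  have "smul A ?r (mul A [x, one A]) = x"
    using strict_unit homogeneous_deg[OF assms] unfolding strict_unit_def by blast
  moreover have "?r * ?r = 1"
    by (simp add: power_int_minus_left)
  ultimately show ?thesis
    by (metis scale_scale scale_one)
qed

lemma mul_one_other:
  assumes "length us + length vs \<noteq> 1"
  shows "mul A (us @ one A # vs) = 0"
proof -
  have "length (us @ one A # vs) \<noteq> 2"
    using assms by simp
  then show ?thesis
    using strict_unit unfolding strict_unit_def by blast
qed

text \<open>Terms from words with a zero letter vanish whatever their sign; this settles the words
  whose shifted degree is not determined.\<close>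

lemma block_zero_mem:
  assumes "multilinear (smul A) sc \<phi>" "0 \<in> set (x @ y @ z)"
  shows "\<phi> (x @ mul A y # z) = 0"
proof (cases "0 \<in> set y")
  case True
  then have "mul A y = 0" by (rule multilinear_zero_mem[OF mul_multilinear])
  then show ?thesis using multilinear_zero[OF assms(1)] by simp
next
  case False
  with assms(2) show ?thesis by (intro multilinear_zero_mem[OF assms(1)]) auto
qed

lemma sdeg_mul:
  assumes "xs \<noteq> []" "list_all (homogeneous A) xs" "mul A xs \<noteq> 0"
  shows "sdeg A (mul A xs) = sdegs A xs + 1"
proof -
  have "list_all2 (\<lambda>d x. x \<in> gr A d) (map (deg A) xs) xs"
    using assms(2) by (auto simp: list_all2_conv_all_nth list_all_length homogeneous_deg)
  from deg_eqI[OF ainf_graded mul_gr[OF assms(1) this] assms(3)] show ?thesis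
    by (simp add: sdeg_def sdegs_def comp_def)
qed

lemma ainf_relation:
  assumes "xs \<noteq> []" "list_all (homogeneous A) xs"
  shows "(\<Sum>(x, y, z)\<in>splits xs. smul A ((- 1) powi sdegs A x) (mul A (x @ mul A y # z))) = 0"
proof -
  note unital_ainf[unfolded ainf_algebra_def, THEN conjunct2, THEN conjunct2, THEN conjunct2, THEN conjunct1,
      THEN spec, THEN mp, THEN mp, OF assms]
  then show ?thesis
    using sum_blocks_eq_splits[where X = xs and f = "\<lambda>x y z. smul A ((- 1) powi sdegs A x) (mul A (x @ mul A y # z))"]
    by (simp only:)
qed

text \<open>Each term of B moves the old entry I to a reduced position, where the cochain vanishes.
  On chains starting with I the differential thus reduces to b.\<close>

lemma pair_connes_B_one:
  assumes "reduced_cochain A \<beta>"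
  shows "pair_chain A \<beta> (connes_B A (one A, xs)) = 0"
proof -
  interpret vector_space "smul A" by (rule ainf_vector_space)
  have "\<beta> (us @ smul A 1 (one A) # vs) w = 0" for us vs w
    using assms unfolding reduced_cochain_def by blast
  then have "\<beta> (us @ one A # vs) w = 0" for us vs w
    by simp
  then show ?thesis
    by (simp add: connes_B_def pair_chain_sum pair_chain_single pair_tensor_def)
qed

text \<open>The first part of b inserts operations into \<open>xs\<close>. In the second part I is
  an argument of m, so strict unitality leaves only m_2(I, x_1) and m_2(x_n, I), the two rotations
  in the last bracket.\<close>

lemma pair_hoch_b_one:
  assumes red: "reduced_cochain A \<beta>" and xs: "xs \<noteq> []" "list_all (homogeneous A) xs" "0 \<notin> set xs"
  shows "pair_chain A \<beta> (hoch_b A (one A, xs)) =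
    (- 1) powi sdegs A xs *
      (\<Sum>(x, y, z)\<in>splits xs. (- 1) powi sdegs A x * \<beta> (x @ mul A y # z) (one A)) +
    (pair_tensor A \<beta> (hd xs, tl xs) -
      (- 1) powi (sdeg A (last xs) * sdegs A (butlast xs)) * pair_tensor A \<beta> (last xs, butlast xs))"
proof -
  interpret vector_space "smul A" by (rule ainf_vector_space)
  let ?n = "length xs"
  have hom: "homogeneous A x" "x \<noteq> 0" if "x \<in> set xs" for x
    using that xs(2,3) by (auto simp: list_all_iff)
  \<comment> \<open>Only for a nonzero unit does \<open>deg\<close> have to be 0. If I were 0,
    m_2(I, x) = x would make the first letter 0.\<close>
  have "one A \<noteq> 0"
  proof
    assume "one A = 0"
    then have "hd xs = 0"
      using mul_one_left[of "hd xs"] multilinear_zero[OF mul_multilinear, of "[]" "[hd xs]"] hom(1) xs(1)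
      by simp
    with xs show False using hd_in_set by metis
  qed
  then have sdeg_one: "sdeg A (one A) = - 1"
    using deg_eqI[OF ainf_graded one_gr] by (simp add: sdeg_def)

  \<comment> \<open>As |I|' = -1 and m raises the shifted degree by 1, the exponents are |x|' - 1
    from b and -(|xs|' + 1) from the pairing.\<close>
  have outer: "(- 1) powi (sdeg A (one A) + sdegs A x) * pair_tensor A \<beta> (one A, x @ mul A y # z) =
      (- 1) powi sdegs A xs * ((- 1) powi sdegs A x * \<beta> (x @ mul A y # z) (one A))"
    if "(x, y, z) \<in> splits xs" for x y z
  proof (cases "mul A y = 0")
    case True
    then show ?thesis
      using multilinear_zero[OF reduced_cochain_multilinear[OF red]] by (simp add: pair_tensor_def)
  next
    case False
    have "xs = x @ y @ z" "y \<noteq> []" using that by (auto simp: splits_def)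
    then have "sdeg A (mul A y) = sdegs A y + 1"
      using xs(2) False by (intro sdeg_mul) auto
    then show ?thesis
      using \<open>xs = x @ y @ z\<close> by (simp add: pair_tensor_def sdeg_one power_int_minus_left)
  qed

  \<comment> \<open>The operation absorbs \<open>i\<close> entries after I and \<open>j\<close>
    entries cyclically before it.\<close>
  define G where "G = (\<lambda>(i, j). (- 1) powi (sdegs A (drop (?n - j) xs) *
        (sdeg A (one A) + sdegs A (take (?n - j) xs))) *
      pair_tensor A \<beta> (mul A (drop (?n - j) xs @ one A # take i xs), drop i (take (?n - j) xs)))"
  have "G (i, j) = 0" if "i + j \<le> ?n" "i + j \<noteq> 1" for i j
  proof -
    have "mul A (drop (?n - j) xs @ one A # take i xs) = 0"
      using that by (intro mul_one_other) auto
    then show ?thesis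
      by (simp add: G_def pair_tensor_def reduced_cochain_zero[OF red])
  qed
  then have "G p = 0" if "p \<in> {(i, j). i + j \<le> ?n} - {(1, 0), (0, 1)}" for p
    using that by (cases p) (auto simp: add_is_1)
  moreover have "finite {(i, j). i + j \<le> ?n}"
    by (rule finite_subset[of _ "{..?n} \<times> {..?n}"]) auto
  ultimately have "(\<Sum>p\<in>{(i, j). i + j \<le> ?n}. G p) = (\<Sum>p\<in>{(1, 0), (0, 1)}. G p)"
    using xs(1) by (intro sum.mono_neutral_right) (auto simp: Suc_le_eq)
  also have "\<dots> = G (1, 0) + G (0, 1)" by simp
  also have "G (1, 0) = pair_tensor A \<beta> (hd xs, tl xs)"
    using xs(1) mul_one_left[OF hom(1)[of "hd xs"]] by (cases xs) (auto simp: G_def)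
  \<comment> \<open>The unit law gives the exponent deg x_n and |I|' = -1 gives -|x_n|'; their sum
    is 1, hence the minus sign.\<close>
  also have "G (0, 1) = - ((- 1) powi (sdeg A (last xs) * sdegs A (butlast xs)) *
      pair_tensor A \<beta> (last xs, butlast xs))"
  proof -
    have last: "homogeneous A (last xs)" "last xs \<noteq> 0"
      using xs(1) hom by auto
    let ?r = "(- 1 :: 'k) powi deg A (last xs)"
    have "deg A (smul A ?r (last xs)) = deg A (last xs)"
      using last by (intro deg_eqI[OF ainf_graded] smul_gr homogeneous_deg) auto
    then have "pair_tensor A \<beta> (smul A ?r (last xs), butlast xs) =
        ?r * pair_tensor A \<beta> (last xs, butlast xs)"
      by (simp add: pair_tensor_def sdeg_def module_hom.scale[OF reduced_cochain_hom[OF red]])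
    moreover have "drop (?n - Suc 0) xs = [last xs]" "take (?n - Suc 0) xs = butlast xs"
      using xs(1) by (cases xs rule: rev_cases; simp)+
    ultimately show ?thesis
      using mul_one_right[OF last(1)] sdeg_one
      by (simp add: G_def sdeg_def power_int_minus_left
          split: if_splits)
  qed
  finally have inner: "(\<Sum>p\<in>{(i, j). i + j \<le> ?n}. G p) = pair_tensor A \<beta> (hd xs, tl xs) -
      (- 1) powi (sdeg A (last xs) * sdegs A (butlast xs)) * pair_tensor A \<beta> (last xs, butlast xs)"
    by simp

  have "pair_chain A \<beta> (hoch_b A (one A, xs)) =
      (\<Sum>(x, y, z)\<in>splits xs. (- 1) powi (sdeg A (one A) + sdegs A x) *
        pair_tensor A \<beta> (one A, x @ mul A y # z)) + (\<Sum>p\<in>{(i, j). i + j \<le> ?n}. G p)"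
    unfolding sum_blocks_eq_splits[where X = xs and f = "\<lambda>x y z. (- 1) powi (sdeg A (one A) + sdegs A x) *
      pair_tensor A \<beta> (one A, x @ mul A y # z)", symmetric]
      hoch_b_def prod.case pair_chain_add pair_chain_sum
    by (intro arg_cong2[where f = "(+)"] sum.cong refl) (auto simp: pair_chain_single Let_def G_def)
  also have "(\<Sum>(x, y, z)\<in>splits xs. (- 1) powi (sdeg A (one A) + sdegs A x) *
        pair_tensor A \<beta> (one A, x @ mul A y # z)) =
      (- 1) powi sdegs A xs *
        (\<Sum>(x, y, z)\<in>splits xs. (- 1) powi sdegs A x * \<beta> (x @ mul A y # z) (one A))"
    unfolding sum_distrib_left by (intro sum.cong refl) (use outer in auto)
  finally show ?thesis by (simp add: inner)
qed

end

section \<open>Invariance of the holonomy\<close>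

lemma splits_map:
  "(\<Sum>(x, y, z)\<in>splits (map f X). g x y z) = (\<Sum>(x, y, z)\<in>splits X. g (map f x) (map f y) (map f z))"
  using sum_blocks_eq_splits[where X = "map f X" and f = g]
    sum_blocks_eq_splits[where X = X and f = "\<lambda>x y z. g (map f x) (map f y) (map f z)"]
  by (simp add: take_map drop_map)

lemma append_eq_replicateD:
  assumes "x @ y @ z = replicate n a"
  shows "x = replicate (length x) a" "y = replicate (length y) a" "z = replicate (length z) a"
    and "length x + length y + length z = n"
proof -
  have "set (x @ y @ z) \<subseteq> {a}" unfolding assms by auto
  then show "x = replicate (length x) a" "y = replicate (length y) a" "z = replicate (length z) a"
    by (auto intro!: replicate_eqI)
  show "length x + length y + length z = n"
    using arg_cong[OF assms, of length] by simp
qed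

lemma pair_tensor_zero_mem:
  assumes "reduced_cochain A \<beta>" "0 \<in> set (w # xs)"
  shows "pair_tensor A \<beta> (w, xs) = 0"
  using assms multilinear_zero_mem[OF reduced_cochain_multilinear[OF assms(1)]]
    reduced_cochain_zero[OF assms(1)] by (auto simp: pair_tensor_def)

lemma neg_diff_zero: "neg_diff A (\<lambda>i xs w. 0) i t = 0"
  by (simp add: neg_diff_def pair_chain_def pair_tensor_def)

context
  fixes A :: "('k::{field_char_0, topological_ab_group_add, t3_space},
               'a::{topological_ab_group_add, t3_space}) ainf"
  assumes A: "unital_ainf_algebra A"
begin

lemma vector_space_mult: "vector_space ((*) :: 'k \<Rightarrow> 'k \<Rightarrow> 'k)"
  by unfold_locales (simp_all add: algebra_simps)

lemma zero_cochain_reduced: "reduced_cochain A (\<lambda>xs w. 0)"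
proof -
  interpret vector_space_pair "smul A" "(*) :: 'k \<Rightarrow> 'k \<Rightarrow> 'k"
    using ainf_vector_space[OF A] vector_space_mult by (simp add: vector_space_pair_def)
  show ?thesis
    by (simp add: reduced_cochain_def module_hom_zero)
qed

lemma zero_neg_cochain: "(\<lambda>i xs w. 0) \<in> neg_cochains A"
  using zero_cochain_reduced
  by (auto simp: neg_cochains_def convergent_cochain_def sums_insertable_def point_sums_ok_def
      path_sums_ok_def freely_summable_on_def potential_term_def bimodule_map_def case_prod_unfold)

lemma neg_cochainD:
  assumes "\<alpha> \<in> neg_cochains A"
  shows "reduced_cochain A (\<alpha> i)" and "sums_insertable (\<lambda>xs. \<alpha> 0 xs (one A))"
    and "a \<in> MC A \<Longrightarrow> point_sums_ok A (\<lambda>xs. \<alpha> 0 xs (one A)) a"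
    and "a \<in> MC A \<Longrightarrow> potential_term A \<alpha> a summable_on UNIV"
    and "gauge_path A p c \<Longrightarrow> path_sums_ok A (\<lambda>xs. \<alpha> 0 xs (one A)) p c"
  using assms by (auto simp: neg_cochains_def convergent_cochain_def Let_def)

section \<open>The pairing with P(a), the holonomy and the potential\<close>

lemma sdegs_replicate:
  assumes "a \<in> gr A 1" "a \<noteq> 0"
  shows "sdegs A (replicate n a) = 0"
  using deg_eqI[OF ainf_graded[OF A] assms] by (induction n) (simp_all add: sdeg_def)

text \<open>The sign is trivial as a nonzero a has shifted degree 0, and the term n = 0 is I
  \<otimes> I, which reduced cochains send to 0.\<close>

lemma pair_tensor_P_term:
  assumes "reduced_cochain A \<beta>" "a \<in> gr A 1"
  shows "pair_tensor A \<beta> (P_term A a n) = (if n = 0 then 0 else \<beta> (replicate n a) (one A))"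
proof (cases "n = 0")
  case True
  interpret vector_space "smul A" by (rule ainf_vector_space[OF A])
  have "\<beta> ([] @ smul A 1 (one A) # []) (one A) = 0"
    using assms(1) unfolding reduced_cochain_def by blast
  then show ?thesis using True by (simp add: P_term_def pair_tensor_def)
next
  case n: False
  show ?thesis
  proof (cases "a = 0")
    case True
    with n have "0 \<in> set (replicate n a)" by simp
    then show ?thesis
      using n multilinear_zero_mem[OF reduced_cochain_multilinear[OF assms(1)]]
      by (simp add: P_term_def pair_tensor_def)
  next
    case False
    then show ?thesis
      using n by (simp add: P_term_def pair_tensor_def sdegs_replicate[OF assms(2)])
  qed
qed

lemma holonomy_has_sum:
  assumes "\<alpha> \<in> neg_cochains A" "a \<in> MC A"
  shows "((\<lambda>n. \<alpha> 0 (replicate n a) (one A)) has_sum holonomy A \<alpha> a) {1..}"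
proof -
  let ?\<phi> = "\<lambda>n. \<alpha> 0 (replicate n a) (one A)"
  have a: "a \<in> gr A 1" using assms(2) by (simp add: MC_def)
  have "(?\<phi> has_sum infsum ?\<phi> {1..}) {1..}"
    by (rule freely_summable_onD[of _ "{1..}"])
      (use neg_cochainD(3)[OF assms] in \<open>auto simp: point_sums_ok_def\<close>)
  moreover from this
  have "((\<lambda>n. pair_tensor A (\<alpha> 0) (P_term A a n)) has_sum infsum ?\<phi> {1..}) UNIV"
    by (rule has_sum_cong_neutral[THEN iffD1, rotated -1])
      (auto simp: pair_tensor_P_term[OF neg_cochainD(1)[OF assms(1)] a])
  then have "holonomy A \<alpha> a = infsum ?\<phi> {1..}"
    unfolding holonomy_def by (rule infsumI)
  ultimately show ?thesis by simp
qed

lemma potential_eq_holonomy: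
  assumes "\<alpha> \<in> neg_cochains A" "a \<in> MC A"
  shows "potential A \<alpha> a = holonomy A \<alpha> a"
proof -
  interpret vector_space "smul A" by (rule ainf_vector_space[OF A])
  let ?\<phi> = "\<lambda>n. \<alpha> 0 (replicate n a) (one A)"
  have "\<alpha> 0 (us @ smul A 1 (one A) # vs) w = 0" for us vs w
    using neg_cochainD(1)[OF assms(1)] unfolding reduced_cochain_def by blast
  then have red: "\<alpha> 0 (us @ one A # vs) w = 0" for us vs w
    by simp
  have rep: "replicate p a @ a # replicate q a = replicate (p + q + 1) a" for p q
    by (simp add: replicate_add replicate_app_Cons_same)
  have pt: "potential_term A \<alpha> a (p, q) = 1 / of_nat (p + q + 1) * ?\<phi> (p + q + 1)" for p q
    unfolding potential_term_def bimodule_map_def prod.case rep red by simp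
  have "(potential_term A \<alpha> a has_sum potential A \<alpha> a) UNIV"
    using neg_cochainD(4)[OF assms] by (simp add: potential_def)
  then have "(?\<phi> has_sum potential A \<alpha> a) {1..}"
  proof (rule has_sum_finite_fibers[where g = "\<lambda>(p, q). p + q + 1"])
    fix n :: nat assume n: "n \<in> {1..}"
    have eq: "{pq \<in> UNIV. (case pq of (p, q) \<Rightarrow> p + q + 1) = n} = (\<lambda>p. (p, n - 1 - p)) ` {..<n}"
      using n by (auto simp: image_iff)
    show "finite {pq \<in> UNIV. (case pq of (p, q) \<Rightarrow> p + q + 1) = n}"
      unfolding eq by simp
    \<comment> \<open>The fiber over \<open>n\<close> consists of n pairs of weight 1/n each, and n
      is invertible in characteristic 0.\<close>
    have "(\<Sum>pq | pq \<in> UNIV \<and> (case pq of (p, q) \<Rightarrow> p + q + 1) = n. potential_term A \<alpha> a pq) =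
        (\<Sum>p<n. 1 / of_nat n * ?\<phi> n)"
      unfolding eq by (subst sum.reindex) (auto simp: inj_on_def pt intro!: sum.cong)
    also have "\<dots> = ?\<phi> n" using n by simp
    finally show "(\<Sum>pq | pq \<in> UNIV \<and> (case pq of (p, q) \<Rightarrow> p + q + 1) = n. potential_term A \<alpha> a pq) =
        ?\<phi> n" .
  qed auto
  then show ?thesis
    using holonomy_has_sum[OF assms] has_sum_unique by blast
qed

section \<open>Vanishing on coboundaries\<close>

lemma neg_diff_one_replicate:
  assumes "\<gamma> \<in> neg_cochains A" "a \<in> gr A 1" "a \<noteq> 0" "n \<ge> 1"
  shows "neg_diff A \<gamma> 0 (one A, replicate n a) =
    (\<Sum>(x, y, z)\<in>splits (replicate n a). \<gamma> 0 (x @ mul A y # z) (one A))"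
proof -
  have hom: "replicate n a \<noteq> []" "list_all (homogeneous A) (replicate n a)" "0 \<notin> set (replicate n a)"
    using assms by (auto simp: list_all_iff homogeneous_def)
  have deg: "sdegs A x = 0" if "(x, y, z) \<in> splits (replicate n a)" for x y z
  proof -
    have "x @ y @ z = replicate n a"
      using that by (simp add: splits_def)
    then have "sdegs A x = sdegs A (replicate (length x) a)"
      by (intro arg_cong[of _ _ "sdegs A"] append_eq_replicateD(1))
    then show ?thesis
      by (simp add: sdegs_replicate[OF assms(2,3)])
  qed
  obtain m where "n = Suc m" using assms(4) by (cases n) auto
  then have rep: "replicate n a = a # replicate m a" "replicate n a = replicate m a @ [a]"
    by (simp_all add: replicate_append_same)
  have "hd (replicate n a) = a" "tl (replicate n a) = replicate m a"
    unfolding rep(1) by simp_all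
  moreover have "last (replicate n a) = a" "butlast (replicate n a) = replicate m a"
    unfolding rep(2) by simp_all
  \<comment> \<open>All letters agree and have shifted degree 0, so the two unit terms of b coincide
    up to opposite signs and cancel.\<close>
  ultimately have "hd (replicate n a) = last (replicate n a)"
      "tl (replicate n a) = butlast (replicate n a)" "sdegs A (butlast (replicate n a)) = 0"
    using sdegs_replicate[OF assms(2,3)] by simp_all
  then show ?thesis
    unfolding neg_diff_def pair_connes_B_one[OF A neg_cochainD(1)[OF assms(1)]]
      pair_hoch_b_one[OF A neg_cochainD(1)[OF assms(1)] hom] sdegs_replicate[OF assms(2,3)]
    using deg by (auto intro!: sum.cong)
qed

text \<open>One triple series is grouped in two ways: fixing i and l leaves the Maurer-Cartan sum
  over j, and fixing i + j + l = n gives the coboundary on I \<otimes> a \<otimes> ... \<otimes>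
  a.\<close>

lemma neg_diff_sums_zero:
  assumes \<gamma>: "\<gamma> \<in> neg_cochains A" and a: "a \<in> MC A" "a \<noteq> 0"
  shows "((\<lambda>n. neg_diff A \<gamma> 0 (one A, replicate n a)) has_sum 0) {1..}"
proof -
  let ?\<phi> = "\<lambda>xs. \<gamma> 0 xs (one A)"
  define f where "f = (\<lambda>(i, j, l). ?\<phi> (replicate i a @ mul A (replicate j a) # replicate l a))"
  let ?X = "{(i, j :: nat, l). 1 \<le> j}"
  have a1: "a \<in> gr A 1" and mc: "((\<lambda>j. mul A (replicate j a)) has_sum 0) {1..}"
    using a(1) by (simp_all add: MC_def)
  have sum: "(f has_sum infsum f ?X) ?X"
    by (rule freely_summable_onD[of _ ?X])
      (use neg_cochainD(3)[OF \<gamma> a(1)] in \<open>auto simp: point_sums_ok_def f_def\<close>)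
  have "infsum f ?X = 0"
  proof (rule has_sum_zero_inner[OF neg_cochainD(2)[OF \<gamma>] _ sum, where f = "\<lambda>j. mul A (replicate j a)"
        and g = "\<lambda>(i, j, l). (i, l)" and T = UNIV and h = "\<lambda>(i, l) j. (i, j, l)" and R = "\<lambda>_. {1..}"
        and us = "\<lambda>(i, l). replicate i a" and vs = "\<lambda>(i, l). replicate l a"])
    show "\<gamma> 0 (us @ 0 # vs) (one A) = 0" for us vs
      using multilinear_zero[OF reduced_cochain_multilinear[OF neg_cochainD(1)[OF \<gamma>]]] .
  qed (use mc in \<open>auto simp: inj_on_def f_def\<close>)
  with sum have "(f has_sum 0) ?X" by simp
  then show ?thesis
  proof (rule has_sum_finite_fibers[where g = "\<lambda>(i, j, l). i + j + l"])
    fix n :: nat assume n: "n \<in> {1..}"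
    show "finite {x \<in> ?X. (case x of (i, j, l) \<Rightarrow> i + j + l) = n}"
      by (rule finite_subset[of _ "{..n} \<times> {..n} \<times> {..n}"]) auto
    have "(\<Sum>p | p \<in> ?X \<and> (case p of (i, j, l) \<Rightarrow> i + j + l) = n. f p) =
        (\<Sum>(x, y, z)\<in>splits (replicate n a). ?\<phi> (x @ mul A y # z))"
    proof (rule sum.reindex_bij_witness[where
          i = "\<lambda>(x, y, z). (length x, length y, length z)"
          and j = "\<lambda>(i, j, l). (replicate i a, replicate j a, replicate l a)"])
      fix p assume "p \<in> splits (replicate n a)"
      then obtain x y z where p: "p = (x, y, z)" "x @ y @ z = replicate n a" "y \<noteq> []"
        by (auto simp: splits_def)
      note part = append_eq_replicateD[OF p(2)]
      from p part(4) show "(case p of (x, y, z) \<Rightarrow> (length x, length y, length z)) \<in>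
          {p \<in> ?X. (case p of (i, j, l) \<Rightarrow> i + j + l) = n}"
        by (auto simp: Suc_le_eq)
      show "(case case p of (x, y, z) \<Rightarrow> (length x, length y, length z) of
          (i, j, l) \<Rightarrow> (replicate i a, replicate j a, replicate l a)) = p"
        using part(1-3) by (simp add: p(1))
    qed (auto simp: splits_def f_def add.assoc simp flip: replicate_add)
    also have "\<dots> = neg_diff A \<gamma> 0 (one A, replicate n a)"
      using neg_diff_one_replicate[OF \<gamma> a1 a(2)] n by simp
    finally show "(\<Sum>p | p \<in> ?X \<and> (case p of (i, j, l) \<Rightarrow> i + j + l) = n. f p) =
        neg_diff A \<gamma> 0 (one A, replicate n a)" .
  qed auto
qed

lemma holonomy_cohomologous:
  assumes "(\<alpha>, \<alpha>') \<in> cohomologous A" "a \<in> MC A"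
  shows "holonomy A \<alpha> a = holonomy A \<alpha>' a"
proof -
  from assms(1) obtain \<gamma> where \<alpha>: "\<alpha> \<in> neg_cochains A" "\<alpha>' \<in> neg_cochains A" "\<gamma> \<in> neg_cochains A"
    and diff: "\<And>t. homogeneous_tensor A t \<Longrightarrow>
        pair_tensor A (\<alpha> 0) t - pair_tensor A (\<alpha>' 0) t = neg_diff A \<gamma> 0 t"
    by (auto simp: cohomologous_def neg_cocycles_def)
  have a1: "a \<in> gr A 1" using assms(2) by (simp add: MC_def)
  note sums = holonomy_has_sum[OF \<alpha>(1) assms(2)] holonomy_has_sum[OF \<alpha>(2) assms(2)]
  show ?thesis
  proof (cases "a = 0")
    \<comment> \<open>The degree of 0 is not determined, but both series vanish term by
      term.\<close>
    case True
    have "\<beta> 0 (replicate n a) (one A) = 0" if "n \<in> {1..}" "\<beta> \<in> neg_cochains A" for \<beta> n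
      using that True multilinear_zero_mem[OF reduced_cochain_multilinear[OF neg_cochainD(1)[OF that(2)]]]
      by simp
    then have "((\<lambda>n. \<beta> 0 (replicate n a) (one A)) has_sum 0) {1..}" if "\<beta> \<in> neg_cochains A" for \<beta>
      using that by (intro has_sum_0) auto
    with \<alpha> sums show ?thesis using has_sum_unique by metis
  next
    case False
    have S: "((\<lambda>n. \<alpha>' 0 (replicate n a) (one A) + neg_diff A \<gamma> 0 (one A, replicate n a))
        has_sum holonomy A \<alpha>' a + 0) {1..}"
      by (intro has_sum_add sums(2) neg_diff_sums_zero \<alpha>(3) assms(2) False)
    have eq: "\<alpha>' 0 (replicate n a) (one A) + neg_diff A \<gamma> 0 (one A, replicate n a) =
        \<alpha> 0 (replicate n a) (one A)" if "n \<in> {1..}" for n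
    proof -
      have "homogeneous_tensor A (one A, replicate n a)"
        using a1 one_gr[OF A] by (auto simp: homogeneous_tensor_def homogeneous_def list_all_iff)
      from diff[OF this] that show ?thesis
        using pair_tensor_P_term[OF neg_cochainD(1)[OF \<alpha>(1)] a1, of 0 n]
          pair_tensor_P_term[OF neg_cochainD(1)[OF \<alpha>(2)] a1, of 0 n]
        by (simp add: P_term_def algebra_simps)
    qed
    have "((\<lambda>n. \<alpha> 0 (replicate n a) (one A)) has_sum holonomy A \<alpha>' a) {1..}"
      using has_sum_cong[THEN iffD1, OF eq S] by simp
    with sums(1) show ?thesis using has_sum_unique by blast
  qed
qed

section \<open>Invariance along gauge paths\<close>

lemma homogeneous_letters:
  assumes "gauge_path A a c"
  shows "list_all (homogeneous A) (map (letter a c) X)"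
  using assms by (auto simp: gauge_path_def list_all_iff homogeneous_def letter_def)

lemma sdegs_letters:
  assumes "gauge_path A a c" "0 \<notin> set (map (letter a c) X)"
  shows "sdegs A (map (letter a c) X) = - int (marks X)"
  using assms(2)
proof (induction X)
  case (Cons l X)
  have "letter a c l \<in> gr A (if fst l then 0 else 1)"
    using assms(1) by (simp add: gauge_path_def letter_def)
  then have "sdeg A (letter a c l) = (if fst l then - 1 else 0)"
    using deg_eqI[OF ainf_graded[OF A]] Cons.prems by (simp add: sdeg_def)
  with Cons show ?case by simp
qed simp

text \<open>Gives the hypothesis \<open>rel\<close> of \<open>gauge_derivative_zero\<close> for
  \<open>mul A\<close>, even word by word, since the A-infinity signs depend only on the
  marks.\<close>

lemma mul_word_relation:
  assumes path: "gauge_path A a c" and X: "X \<noteq> []"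
  shows "(\<Sum>(x, y, z)\<in>splits X. smul A ((- 1) ^ marks x)
      (mul A (map (letter a c) x @ mul A (map (letter a c) y) # map (letter a c) z))) = 0"
proof (cases "0 \<in> set (map (letter a c) X)")
  case True
  interpret vector_space "smul A" by (rule ainf_vector_space[OF A])
  have "mul A (map (letter a c) x @ mul A (map (letter a c) y) # map (letter a c) z) = 0"
    if "(x, y, z) \<in> splits X" for x y z
    using True that by (intro block_zero_mem[OF A mul_multilinear[OF A]]) (auto simp: splits_def)
  then show ?thesis by (intro sum.neutral) auto
next
  case False
  have "(\<Sum>(x, y, z)\<in>splits X. smul A ((- 1) powi sdegs A (map (letter a c) x))
      (mul A (map (letter a c) x @ mul A (map (letter a c) y) # map (letter a c) z))) = 0"
    using ainf_relation[OF A _ homogeneous_letters[OF path], of X] X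
    by (simp add: splits_map)
  moreover have "(- 1 :: 'k) powi sdegs A (map (letter a c) x) = (- 1) ^ marks x"
    if "(x, y, z) \<in> splits X" for x y z
    using False that
    by (subst sdegs_letters[OF path]) (auto simp: splits_def minus_one_powi_minus_of_nat)
  then have "(\<Sum>(x, y, z)\<in>splits X. smul A ((- 1) ^ marks x)
      (mul A (map (letter a c) x @ mul A (map (letter a c) y) # map (letter a c) z))) =
    (\<Sum>(x, y, z)\<in>splits X. smul A ((- 1) powi sdegs A (map (letter a c) x))
      (mul A (map (letter a c) x @ mul A (map (letter a c) y) # map (letter a c) z)))"
    by (intro sum.cong refl) auto
  ultimately show ?thesis by simp
qed

text \<open>Order 0 is the Maurer-Cartan equation of a(0). Order M+1 is
  \<open>gauge_derivative_zero\<close> with \<open>\<phi>\<close> = \<open>mul A\<close>, which uses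
  the orders up to M.\<close>

lemma gauge_path_MC:
  assumes path: "gauge_path A a c" and start: "coeff a 0 \<in> MC A"
  shows "((\<lambda>r. mul A (map (coeff a) r)) has_sum 0) {r. r \<noteq> [] \<and> sum_list r = d}"
proof (induction d rule: less_induct)
  case (less d)
  show ?case
  proof (cases d)
    case 0
    then show ?thesis
      using start unfolding 0 has_sum_weight_zero by (simp add: MC_def)
  next
    case (Suc M)
    have "((\<lambda>r. mul A (map (coeff a) r)) has_sum 0) {r. sum_list r = Suc M}"
    proof (rule gauge_derivative_zero[OF mul_multilinear[OF A] mul_insertable[OF A] ainf_vector_space[OF A] _ path])
      show "path_sums_ok A (mul A) a c"
        using path by (simp add: gauge_path_def)
      show "(\<Sum>X\<in>marked_words n M. \<Sum>(x, y, z)\<in>splits X. smul A ((- 1) ^ marks x)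
          (mul A (map (letter a c) x @ mul A (map (letter a c) y) # map (letter a c) z))) = 0" for n
        by (intro sum.neutral ballI mul_word_relation[OF path]) (auto simp: marked_words_def)
    qed (use less Suc in auto)
    moreover have "{r. sum_list r = Suc M} = {r. r \<noteq> [] \<and> sum_list r = d}"
      using Suc by auto
    ultimately show ?thesis by simp
  qed
qed

text \<open>
  The two terms of \<open>b(I \<otimes> x\<^sub>1 \<otimes> \<cdots> \<otimes> x\<^sub>n)\<close> that involve the unit are
  \<open>x\<^sub>1 \<otimes> x\<^sub>2 \<otimes> \<cdots> \<otimes> x\<^sub>n\<close> and its cyclic rotation with opposite sign, so they cancel after summation
  over all words of a given length and weight.
\<close>

lemma cocycle_word_relation:
  assumes \<alpha>: "\<alpha> \<in> neg_cocycles A" and path: "gauge_path A a c"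
  shows "(\<Sum>X\<in>marked_words n M. \<Sum>(x, y, z)\<in>splits X. (- 1) ^ marks x *
      \<alpha> 0 (map (letter a c) x @ mul A (map (letter a c) y) # map (letter a c) z) (one A)) = 0"
proof -
  let ?e = "map (letter a c)"
  have \<alpha>': "\<alpha> \<in> neg_cochains A"
    using \<alpha> by (simp add: neg_cocycles_def)
  note red = neg_cochainD(1)[OF \<alpha>', of 0]
  define D where "D X = pair_tensor A (\<alpha> 0) (hd (?e X), tl (?e X))" for X
  define D' where "D' X = pair_tensor A (\<alpha> 0) (last (?e X), butlast (?e X))" for X
  have word: "(\<Sum>(x, y, z)\<in>splits X. (- 1) ^ marks x * \<alpha> 0 (?e x @ mul A (?e y) # ?e z) (one A)) =
      D X - D' X" if X: "X \<in> marked_words n M" for X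
  proof (cases "0 \<in> set (?e X)")
    case True
    have "\<alpha> 0 (?e x @ mul A (?e y) # ?e z) (one A) = 0" if "(x, y, z) \<in> splits X" for x y z
      using True that
      by (intro block_zero_mem[OF A reduced_cochain_multilinear[OF red]]) (auto simp: splits_def)
    then have "(\<Sum>(x, y, z)\<in>splits X. (- 1) ^ marks x * \<alpha> 0 (?e x @ mul A (?e y) # ?e z) (one A)) = 0"
      by (intro sum.neutral) auto
    moreover have "D X = 0"
      unfolding D_def using True by (intro pair_tensor_zero_mem[OF red]) (cases X; auto)
    moreover have "D' X = 0"
      unfolding D'_def using True
      by (intro pair_tensor_zero_mem[OF red]) (cases X rule: rev_cases; auto)
    ultimately show ?thesis by simp
  next
    case False
    from X obtain X' l where X': "X = X' @ [l]" "marks X' + marks [l] = 1"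
      by (cases X rule: rev_cases) (auto simp: marked_words_def)
    have sd: "sdegs A (?e x) = - int (marks x)" if "set x \<subseteq> set X" for x
      using False that by (intro sdegs_letters[OF path]) auto
    have "sdeg A (last (?e X)) = - int (marks [l])" "sdegs A (butlast (?e X)) = - int (marks X')"
      using sd[of "[l]"] sd[of X'] by (auto simp: X'(1))
    \<comment> \<open>With a single mark, either the last letter or the rest of the word has shifted
      degree 0, so the rotation carries no sign.\<close>
    moreover have "marks [l] = 0 \<or> marks X' = 0"
      using X'(2) by linarith
    ultimately have rot: "sdeg A (last (?e X)) * sdegs A (butlast (?e X)) = 0"
      by auto
    have ne: "?e X \<noteq> []"
      using X'(1) by simp
    note hom = homogeneous_letters[OF path, of X]
    then have "homogeneous_tensor A (one A, ?e X)"
      using one_gr[OF A] by (auto simp: homogeneous_tensor_def homogeneous_def)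
    then have "neg_diff A \<alpha> 0 (one A, ?e X) = 0"
      using \<alpha> by (simp add: neg_cocycles_def)
    then have "pair_chain A (\<alpha> 0) (hoch_b A (one A, ?e X)) = 0"
      by (simp add: neg_diff_def pair_connes_B_one[OF A neg_cochainD(1)[OF \<alpha>']])
    \<comment> \<open>The total degree -1 puts a minus sign before the insertion sum, which
      therefore equals \<open>D X - D' X\<close> rather than its negative.\<close>
    moreover have "sdegs A (?e X) = - 1"
      using sd[of X] X by (simp add: marked_words_def)
    ultimately have "(\<Sum>(x, y, z)\<in>splits (?e X). (- 1) powi sdegs A x * \<alpha> 0 (x @ mul A y # z) (one A)) =
        D X - D' X"
      unfolding pair_hoch_b_one[OF A red ne hom False] rot D_def D'_def by simp
    moreover have "(- 1 :: 'k) powi sdegs A (?e x) = (- 1) ^ marks x" if "(x, y, z) \<in> splits X" for x y z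
      using that by (subst sd) (auto simp: splits_def minus_one_powi_minus_of_nat)
    then have "(\<Sum>(x, y, z)\<in>splits X. (- 1) ^ marks x * \<alpha> 0 (?e x @ mul A (?e y) # ?e z) (one A)) =
        (\<Sum>(x, y, z)\<in>splits (?e X). (- 1) powi sdegs A x * \<alpha> 0 (x @ mul A y # z) (one A))"
      unfolding splits_map by (intro sum.cong refl) auto
    ultimately show ?thesis by simp
  qed
  have "(\<Sum>X\<in>marked_words n M. D' X) = (\<Sum>X\<in>marked_words n M. D X)"
  \<comment> \<open>Moving the last letter to the front permutes the marked words, as it preserves
    length, weight and marks.\<close>
  proof (rule sum.reindex_bij_witness[where i = rotate1 and j = "\<lambda>X. last X # butlast X"])
    fix X assume X: "X \<in> marked_words n M"
    then have ne: "X \<noteq> []" by (auto simp: marked_words_def)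
    then obtain X' l where X': "X = X' @ [l]" by (cases X rule: rev_cases) auto
    show "rotate1 (last X # butlast X) = X" using ne by simp
    show "last X # butlast X \<in> marked_words n M"
      using X by (auto simp: X' marked_words_def)
    show "D (last X # butlast X) = D' X"
      by (simp add: D_def D'_def X')
    obtain m Y where Y: "X = m # Y" using ne by (cases X) auto
    show "last (rotate1 X) # butlast (rotate1 X) = X" by (simp add: Y)
    show "rotate1 X \<in> marked_words n M"
      using X by (auto simp: Y marked_words_def)
  qed
  then show ?thesis
    by (simp add: word sum_subtractf)
qed

text \<open>The series over all nonempty words in the coefficients of a(t) is summed in two ways. By
  weight, only t^0 survives and gives the holonomy at a(0); by length, the terms are \<phi>(a(1),
  ..., a(1)) and give the holonomy at a(1).\<close>

lemma holonomy_gauge_rel: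
  assumes \<alpha>: "\<alpha> \<in> neg_cocycles A" and xy: "(x, y) \<in> gauge_rel A"
  shows "holonomy A \<alpha> x = holonomy A \<alpha> y"
proof -
  have \<alpha>': "\<alpha> \<in> neg_cochains A"
    using \<alpha> by (simp add: neg_cocycles_def)
  from xy obtain a c where MC: "x \<in> MC A" "y \<in> MC A" and path: "gauge_path A a c"
    and ends: "coeff a 0 = x" "(\<Sum>i\<le>degree a. coeff a i) = y"
    by (auto simp: gauge_rel_def)
  define \<phi> where "\<phi> = (\<lambda>xs. \<alpha> 0 xs (one A))"
  have ml: "multilinear (smul A) (*) \<phi>"
    unfolding \<phi>_def by (rule reduced_cochain_multilinear[OF neg_cochainD(1)[OF \<alpha>']])
  have ok: "path_sums_ok A \<phi> a c" and ins: "sums_insertable \<phi>"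
    unfolding \<phi>_def using neg_cochainD(5)[OF \<alpha>' path] neg_cochainD(2)[OF \<alpha>'] .
  let ?f = "\<lambda>u. \<phi> (map (coeff a) u)"
  define T where "T = infsum ?f {u. u \<noteq> []}"
  have T: "(?f has_sum T) {u. u \<noteq> []}"
    unfolding T_def
    by (rule freely_summable_onD[of _ "{u. u \<noteq> []}"]) (use ok in \<open>auto simp: path_sums_ok_def Let_def\<close>)

  have "((\<lambda>N. if N = 0 then holonomy A \<alpha> x else 0) has_sum T) (UNIV :: nat set)"
  proof (rule has_sum_fibers[OF T, where g = sum_list])
    fix N :: nat
    show "(?f has_sum (if N = 0 then holonomy A \<alpha> x else 0)) {u \<in> {u. u \<noteq> []}. sum_list u = N}"
    proof (cases N)
      case 0
      have "((\<lambda>k. \<phi> (replicate k (coeff a 0))) has_sum holonomy A \<alpha> x) {1..}"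
        unfolding ends \<phi>_def by (rule holonomy_has_sum[OF \<alpha>' MC(1)])
      then have "(?f has_sum holonomy A \<alpha> x) {u. u \<noteq> [] \<and> sum_list u = 0}"
        by (rule has_sum_weight_zero[THEN iffD2])
      then show ?thesis using 0 by simp
    next
      case (Suc M)
      have "(?f has_sum 0) {u. sum_list u = Suc M}"
      proof (rule gauge_derivative_zero[OF ml ins vector_space_mult ok path])
        show "(\<Sum>X\<in>marked_words n M. \<Sum>(x, y, z)\<in>splits X. (- 1) ^ marks x *
            \<phi> (map (letter a c) x @ mul A (map (letter a c) y) # map (letter a c) z)) = 0" for n
          unfolding \<phi>_def by (rule cocycle_word_relation[OF \<alpha> path])
      qed (use gauge_path_MC[OF path] ends MC(1) in simp)
      moreover have "{u. sum_list u = Suc M} = {u \<in> {u. u \<noteq> []}. sum_list u = N}"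
        using Suc by auto
      ultimately show ?thesis using Suc by simp
    qed
  qed auto
  moreover have "((\<lambda>N. if N = 0 then holonomy A \<alpha> x else 0) has_sum holonomy A \<alpha> x) (UNIV :: nat set)"
  proof -
    have "((\<lambda>N. if N = 0 then holonomy A \<alpha> x else 0) has_sum holonomy A \<alpha> x) {0 :: nat}"
      by (rule has_sum_finiteI) auto
    then show ?thesis
      by (rule has_sum_cong_neutral[THEN iffD1, rotated -1]) auto
  qed
  ultimately have x: "holonomy A \<alpha> x = T"
    using has_sum_unique by (metis (no_types, lifting))

  have "((\<lambda>n. \<phi> (replicate n y)) has_sum T) {1..}"
  proof (rule has_sum_fibers[OF T, where g = length])
    fix n :: nat assume n: "n \<in> {1..}"
    let ?U = "{u. set u \<subseteq> {..degree a} \<and> length u = n}"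
    have "(?f has_sum \<phi> (replicate n y)) ?U"
      using multilinear_expand[OF ml, of "[]" n "coeff a" "degree a"] ends(2)
      by (intro has_sum_finiteI finite_lists_length_eq) simp_all
    then show "(?f has_sum \<phi> (replicate n y)) {u \<in> {u. u \<noteq> []}. length u = n}"
    \<comment> \<open>\<open>multilinear_expand\<close> only uses exponents up to
      \<open>degree a\<close>; all other words contain a zero coefficient.\<close>
    proof (rule has_sum_cong_neutral[THEN iffD1, rotated -1])
      fix u assume "u \<in> {u \<in> {u. u \<noteq> []}. length u = n} - ?U"
      then have "\<not> set u \<subseteq> {..degree a}" by auto
      then obtain i where "i \<in> set u" "i > degree a" by (auto simp: subset_iff not_le)
      then have "0 \<in> set (map (coeff a) u)"
        using coeff_eq_0 by (metis image_eqI list.set_map)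
      then show "?f u = 0" by (rule multilinear_zero_mem[OF ml])
    qed (use n in auto)
  qed (auto simp: Suc_le_eq)
  then have "T = holonomy A \<alpha> y"
    using holonomy_has_sum[OF \<alpha>' MC(2)] has_sum_unique unfolding \<phi>_def by blast
  with x show ?thesis by simp
qed

lemma holonomy_gauge_equiv:
  assumes \<alpha>: "\<alpha> \<in> neg_cocycles A" and xy: "(x, y) \<in> gauge_equiv A"
  shows "holonomy A \<alpha> x = holonomy A \<alpha> y"
proof -
  from xy have "(x, y) \<in> (gauge_rel A \<union> (gauge_rel A)\<inverse>)\<^sup>*"
    by (simp add: gauge_equiv_def)
  then show ?thesis
    by (induction rule: rtrancl_induct) (auto dest: holonomy_gauge_rel[OF \<alpha>])
qed

text \<open>Ensures that a class contains the cocycle defining it; the zero cochain serves as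
  \<gamma>.\<close>

lemma cohomologous_refl: "\<alpha> \<in> neg_cocycles A \<Longrightarrow> (\<alpha>, \<alpha>) \<in> cohomologous A"
  using zero_neg_cochain neg_diff_zero by (force simp: cohomologous_def)

end

section \<open>The induced map on cohomology and moduli classes\<close>

theorem theorem4p4:
  fixes A :: "('k::{field_char_0, topological_ab_group_add, t3_space},
               'a::{topological_ab_group_add, t3_space}) ainf"
  assumes "unital_ainf_algebra A"
  shows "\<exists>\<Psi> \<in> HC_neg A \<rightarrow>\<^sub>E MC_functions A.
           (\<forall>\<alpha> \<in> neg_cocycles A. \<forall>a \<in> MC A.
              \<Psi> (cohomologous A `` {\<alpha>}) (gauge_equiv A `` {a}) = potential A \<alpha> a) \<and>
           (\<forall>\<alpha> \<in> neg_cocycles A. \<forall>a \<in> MC A.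
              \<Psi> (cohomologous A `` {\<alpha>}) (gauge_equiv A `` {a}) = holonomy A \<alpha> a)"
proof -
  \<comment> \<open>Representatives are chosen arbitrarily; \<open>hol\<close> shows that the value
    does not depend on them.\<close>
  define \<Psi> where "\<Psi> = (\<lambda>C\<in>HC_neg A. \<lambda>X\<in>MC_moduli A.
      holonomy A (SOME \<alpha>. \<alpha> \<in> C) (SOME a. a \<in> X))"
  have hol: "\<Psi> (cohomologous A `` {\<alpha>}) (gauge_equiv A `` {a}) = holonomy A \<alpha> a"
    if \<alpha>: "\<alpha> \<in> neg_cocycles A" and a: "a \<in> MC A" for \<alpha> a
  proof -
    let ?\<beta> = "SOME \<beta>. \<beta> \<in> cohomologous A `` {\<alpha>}" and ?b = "SOME b. b \<in> gauge_equiv A `` {a}"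
    have "?\<beta> \<in> cohomologous A `` {\<alpha>}"
      by (rule someI[of _ \<alpha>]) (use cohomologous_refl[OF assms \<alpha>] in blast)
    then have \<beta>: "(\<alpha>, ?\<beta>) \<in> cohomologous A" by blast
    have "?b \<in> gauge_equiv A `` {a}"
      by (rule someI[of _ a]) (use a in \<open>simp add: gauge_equiv_def\<close>)
    then have b: "(a, ?b) \<in> gauge_equiv A" by blast
    then have "?b \<in> MC A" unfolding gauge_equiv_def by blast
    \<comment> \<open>The cocycle is exchanged at the chosen point \<open>?b\<close> first; then
      gauge invariance for \<alpha> moves \<open>?b\<close> to a.\<close>
    from holonomy_cohomologous[OF assms \<beta> this] holonomy_gauge_equiv[OF assms \<alpha> b]
    have "holonomy A ?\<beta> ?b = holonomy A \<alpha> a" by simp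
    moreover have "cohomologous A `` {\<alpha>} \<in> HC_neg A" "gauge_equiv A `` {a} \<in> MC_moduli A"
      using \<alpha> a by (simp_all add: HC_neg_def MC_moduli_def quotientI)
    ultimately show ?thesis by (simp add: \<Psi>_def)
  qed
  moreover have "potential A \<alpha> a = holonomy A \<alpha> a"
    if "\<alpha> \<in> neg_cocycles A" "a \<in> MC A" for \<alpha> a
    using that by (intro potential_eq_holonomy[OF assms]) (simp_all add: neg_cocycles_def)
  moreover have "\<Psi> \<in> HC_neg A \<rightarrow>\<^sub>E MC_functions A"
    by (auto simp: \<Psi>_def MC_functions_def)
  ultimately show ?thesis by (intro bexI[of _ \<Psi>]) auto
qed

end
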